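(* Fix an equation $(f,q,w)$ as in the context with $\prod_{i=0}^{N-1}(1/f_i)>0$. Let $\gamma\in(-\pi,0)\cup(0,\pi)$ and $K=(k_{ij})\in SL(2,\mathbb R)$ with $k_{11}-f_0k_{12}\neq0$. Let $\mathbf V_K=\begin{pmatrix}k_{21}&k_{22}&0&0\\0&0&0&1\end{pmatrix}$. For $M\in\{K,-K\}$ with entries $m_{ij}$, write $\lambda_j(M)$, $\lambda_j(-M)$, $\lambda_j(e^{i\gamma}M)$, $\lambda_j(\mathbf V_K)$ for the eigenvalues with boundary conditions $[M|-I]$, $[-M|-I]$, $[e^{i\gamma}M|-I]$, $\mathbf V_K$; put $m_j=\min\{\lambda_j(M),\lambda_j(-M)\}$, $M_j=\max\{\lambda_j(M),\lambda_j(-M)\}$; and say $P(M)$ holds if for every $0\le j\le N-1$: $\lambda_j(M)<\lambda_j(e^{i\gamma}M)<\lambda_j(-M)$ for $j$ even and $\lambda_j(-M)<\lambda_j(e^{i\gamma}M)<\lambda_j(M)$ for $j$ odd. Then for each $M\in\{K,-K\}$: (i) if $m_{11}-f_0m_{12}>0$ and $f_0m_{22}-m_{21}>0$: $P(M)$ holds, $\lambda_j(\mathbf V_K)\le m_j$ for $0\le j\le N-1$, and $M_j\le\lambda_{j+1}(\mathbf V_K)$ for $0\le j\le N-2$; (ii) if $m_{11}-f_0m_{12}>0$ and $f_0m_{22}-m_{21}<0$: $P(M)$ holds, $M_j\le\lambda_j(\mathbf V_K)\le m_{j+1}$ for $0\le j\le N-2$, and $M_{N-1}\le\lambda_{N-1}(\mathbf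 V_K)$; (iii) if $m_{11}-f_0m_{12}>0$ and $f_0m_{22}-m_{21}=0$: $P(M)$ holds and $M_j\le\lambda_j(\mathbf V_K)\le m_{j+1}$ for $0\le j\le N-2$.
   Context: Let $N\ge2$ be an integer. An equation is given by real sequences $f=\{f_n\}_{n=0}^N$, $q=\{q_n\}_{n=1}^N$, $w=\{w_n\}_{n=1}^N$ with $f_n\neq0$, $w_n>0$; it is $-\nabla(f_n\Delta y_n)+q_ny_n=\lambda w_ny_n$, $1\le n\le N$, for $y=\{y_n\}_{n=0}^{N+1}$, $\Delta y_n=y_{n+1}-y_n$, $\nabla y_n=y_n-y_{n-1}$. A boundary condition $[A\,|\,B]$ (equivalently the $2\times4$ coefficient matrix $(A,B)$ of rank 2) is $A(y_0,f_0\Delta y_0)^T+B(y_N,f_N\Delta y_N)^T=0$; matrices differing by left multiplication by an invertible $2\times2$ complex matrix give the same condition (so $\mathbf V_{-K}=\mathbf V_K$). $SL(2,\mathbb R)$: real $2\times2$ matrices of determinant 1; $I$ the identity. Eigenvalues ($\lambda$ with a nontrivial solution) are real; multiplicity = dimension of the solution space; counted with multiplicity they are ordered $\lambda_0\le\lambda_1\le\cdots$. *)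

theory Defs
  imports "HOL-Analysis.Analysis" "HOL-Library.Function_Algebras"
begin

text \<open>A boundary condition [A|B] is represented by the pair (A,B) of complex 2x2 matrices.
  A solution y = (y_0,...,y_{N+1}) is represented by a function nat => complex vanishing
  beyond index N+1, so the solutions form a complex vector space under pointwise operations.\<close>

type_synonym bcond = "(complex^2^2) \<times> (complex^2^2)"

definition sl_sol_space ::
  "(nat \<Rightarrow> real) \<Rightarrow> (nat \<Rightarrow> real) \<Rightarrow> (nat \<Rightarrow> real) \<Rightarrow> nat \<Rightarrow> bcond \<Rightarrow> complex \<Rightarrow> (nat \<Rightarrow> complex) set"
where
  "sl_sol_space f q w N bc lam =
     {y. (\<forall>n>N+1. y n = 0)
       \<and> (\<forall>n\<in>{1..N}.
            - (complex_of_real (f n) * (y (Suc n) - y n) - complex_of_real (f (n-1)) * (y n - y (n-1)))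
            + complex_of_real (q n) * y n = lam * complex_of_real (w n) * y n)
       \<and> fst bc *v vector [y 0, complex_of_real (f 0) * (y 1 - y 0)]
         + snd bc *v vector [y N, complex_of_real (f N) * (y (Suc N) - y N)] = 0}"

definition seq_scale :: "complex \<Rightarrow> (nat \<Rightarrow> complex) \<Rightarrow> (nat \<Rightarrow> complex)" where
  "seq_scale c y = (\<lambda>n. c * y n)"

definition sl_is_eig :: "(nat \<Rightarrow> real) \<Rightarrow> (nat \<Rightarrow> real) \<Rightarrow> (nat \<Rightarrow> real) \<Rightarrow> nat \<Rightarrow> bcond \<Rightarrow> complex \<Rightarrow> bool" where
  "sl_is_eig f q w N bc lam \<longleftrightarrow> (\<exists>y\<in>sl_sol_space f q w N bc lam. y \<noteq> 0)"

definition sl_mult :: "(nat \<Rightarrow> real) \<Rightarrow> (nat \<Rightarrow> real) \<Rightarrow> (nat \<Rightarrow> real) \<Rightarrow> nat \<Rightarrow> bcond \<Rightarrow> complex \<Rightarrow> nat" where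
  "sl_mult f q w N bc lam = vector_space.dim seq_scale (sl_sol_space f q w N bc lam)"

definition sl_count :: "(nat \<Rightarrow> real) \<Rightarrow> (nat \<Rightarrow> real) \<Rightarrow> (nat \<Rightarrow> real) \<Rightarrow> nat \<Rightarrow> bcond \<Rightarrow> real \<Rightarrow> nat" where
  "sl_count f q w N bc x =
     (\<Sum>\<mu>\<in>{\<mu>::real. sl_is_eig f q w N bc (complex_of_real \<mu>) \<and> \<mu> \<le> x}.
        sl_mult f q w N bc (complex_of_real \<mu>))"

text \<open>The j-th eigenvalue (j = 0,1,...) in the nondecreasing list of eigenvalues
  counted with multiplicity: the least x such that more than j eigenvalues are \<le> x.\<close>
definition sl_eig :: "(nat \<Rightarrow> real) \<Rightarrow> (nat \<Rightarrow> real) \<Rightarrow> (nat \<Rightarrow> real) \<Rightarrow> nat \<Rightarrow> bcond \<Rightarrow> nat \<Rightarrow> real" where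
  "sl_eig f q w N bc j = Inf {x. j < sl_count f q w N bc x}"

definition cmat :: "real^2^2 \<Rightarrow> complex^2^2" where
  "cmat M = (\<chi> i j. complex_of_real (M$i$j))"

definition bc_coupled :: "complex^2^2 \<Rightarrow> bcond" where
  "bc_coupled A = (A, - mat 1)"

definition bc_V :: "real^2^2 \<Rightarrow> bcond" where
  "bc_V K = (cmat (\<chi> i j. if i = 1 then K$2$j else 0), cmat (\<chi> i j. if i = 2 \<and> j = 2 then 1 else 0))"

end

theory Submission
  imports Defs "HOL-Computational_Algebra.Fundamental_Theorem_Algebra"
begin

text \<open>
  Let \<open>\<Phi>(\<lambda>)\<close> be the transfer matrix taking \<open>(y\<^sub>0, f\<^sub>0 \<Delta>y\<^sub>0)\<close> to \<open>(y\<^sub>N, f\<^sub>N \<Delta>y\<^sub>N)\<close>; it has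
  determinant 1 and polynomial entries. The eigenvalues for \<open>[e\<^bsup>i\<gamma>\<^esup>M|-I]\<close> are the solutions of
  \<open>D(\<lambda>) = 2 cos \<gamma>\<close> with \<open>D = tr (M\<inverse> \<Phi>)\<close>, a polynomial of degree \<open>N\<close>. The Lagrange identity writes
  \<open>D'\<close> as a sum of values of a quadratic form of discriminant \<open>D\<^sup>2 - 4\<close>; where \<open>|D| \<le> 2\<close> this form
  is semidefinite, and a vanishing \<open>D'\<close> forces \<open>\<Phi> = \<plusminus>M\<close>, that is, a double eigenvalue.

  The eigenvalues for the separated condition are the zeros of a polynomial \<open>g\<close>, real and simple by
  the Lagrange identity. At such a zero a fixed vector is an eigenvector of \<open>M\<inverse> \<Phi>\<close>, with eigenvalue \<open>s\<close>
  say, so \<open>D = s + 1/s\<close> and \<open>|D| \<ge> 2\<close>, while \<open>D g' < 0\<close>. Thus the sign of \<open>D\<close> alternates along the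
  zeros of \<open>g\<close>. Together with the behaviour of \<open>D\<close> at infinity this yields \<open>N\<close> consecutive bands,
  separated by the zeros of \<open>g\<close>, across each of which \<open>D\<close> runs between \<open>2\<close> and \<open>-2\<close>; a count of the
  roots of \<open>D - 2 cos \<gamma>\<close> with multiplicity shows that each band contributes exactly one eigenvalue.
\<close>

section \<open>The initial value problem\<close>

text \<open>\<open>slU\<close> and \<open>slV\<close> give \<open>y\<^sub>n\<close> and \<open>f\<^sub>n \<Delta>y\<^sub>n\<close> as polynomials in \<open>\<lambda>\<close> for the solution with initial
  data \<open>(a, b)\<close> at index 0. The field is left general because both the real and the complex
  polynomial are needed.\<close>

primrec sl_pair ::
  "(nat \<Rightarrow> 'a::field) \<Rightarrow> (nat \<Rightarrow> 'a) \<Rightarrow> (nat \<Rightarrow> 'a) \<Rightarrow> 'a \<Rightarrow> 'a \<Rightarrow> nat \<Rightarrow> 'a poly \<times> 'a poly"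
where
  "sl_pair f q w a b 0 = ([:a:], [:b:])"
| "sl_pair f q w a b (Suc n) =
     (let (u, v) = sl_pair f q w a b n; u' = u + smult (1 / f n) v
      in (u', v + [:q (Suc n), - w (Suc n):] * u'))"

definition slU where "slU f q w a b n = fst (sl_pair f q w a b n)"
definition slV where "slV f q w a b n = snd (sl_pair f q w a b n)"

lemma slU_0 [simp]: "slU f q w a b 0 = [:a:]"
  and slV_0 [simp]: "slV f q w a b 0 = [:b:]"
  by (simp_all add: slU_def slV_def)

lemma slU_Suc: "slU f q w a b (Suc n) = slU f q w a b n + smult (1 / f n) (slV f q w a b n)"
  and slV_Suc: "slV f q w a b (Suc n) =
    slV f q w a b n + [:q (Suc n), - w (Suc n):] * slU f q w a b (Suc n)"
  by (simp_all add: slU_def slV_def Let_def split: prod.split)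

lemma slUV_linear:
  "slU f q w a b n = smult a (slU f q w 1 0 n) + smult b (slU f q w 0 1 n) \<and>
   slV f q w a b n = smult a (slV f q w 1 0 n) + smult b (slV f q w 0 1 n)"
proof (induction n)
  case (Suc n)
  have *: "slU f q w a b (Suc n) = smult a (slU f q w 1 0 (Suc n)) + smult b (slU f q w 0 1 (Suc n))"
    using Suc by (simp add: slU_Suc smult_add_right mult.commute)
  show ?case
    using Suc by (simp only: * slV_Suc[of f q w _ _ n]) (simp add: algebra_simps smult_add_right)
qed simp

text \<open>Both half steps of the recursion are unipotent shears of the pair \<open>(u, v)\<close>,
  so the determinant formed by two solutions keeps its initial value.\<close>

lemma slUV_wronskian:
  "slU f q w a b n * slV f q w c d n - slU f q w c d n * slV f q w a b n = [:a * d - b * c:]"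
proof (induction n)
  case (Suc n)
  have "slU f q w a b (Suc n) * slV f q w c d (Suc n) - slU f q w c d (Suc n) * slV f q w a b (Suc n)
      = slU f q w a b (Suc n) * slV f q w c d n - slU f q w c d (Suc n) * slV f q w a b n"
    unfolding slV_Suc by (simp add: algebra_simps)
  also have "\<dots> = slU f q w a b n * slV f q w c d n - slU f q w c d n * slV f q w a b n"
    unfolding slU_Suc by (simp add: algebra_simps)
  finally show ?case using Suc by simp
qed (simp add: algebra_simps)

text \<open>The parameter enters only through the factor \<open>q - w \<lambda>\<close> of the
  second half step, so differentiation adds one term \<open>w u u\<close> per index, while the first
  half step is a constant shear and adds nothing. The signs in \<open>discr_deriv_eq_0\<close> and
  \<open>vpoly_root\<close> come from this identity.\<close>

lemma slUV_lagrange: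
  "pderiv (slU f q w a b n) * slV f q w c d n - slU f q w c d n * pderiv (slV f q w a b n)
   = (\<Sum>k=1..n. smult (w k) (slU f q w a b k * slU f q w c d k))"
proof (induction n)
  case 0 then show ?case by (simp add: pderiv_pCons)
next
  case (Suc n)
  have d: "pderiv [:x, - y:] = [:- y:]" for x y :: 'a by (simp add: pderiv_pCons)
  have "pderiv (slU f q w a b (Suc n)) * slV f q w c d (Suc n)
          - slU f q w c d (Suc n) * pderiv (slV f q w a b (Suc n))
      = pderiv (slU f q w a b (Suc n)) * slV f q w c d n
          - slU f q w c d (Suc n) * pderiv (slV f q w a b n)
        + smult (w (Suc n)) (slU f q w a b (Suc n) * slU f q w c d (Suc n))"
    unfolding slV_Suc pderiv_add pderiv_mult d by (simp add: algebra_simps)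
  also have "pderiv (slU f q w a b (Suc n)) * slV f q w c d n
          - slU f q w c d (Suc n) * pderiv (slV f q w a b n)
      = pderiv (slU f q w a b n) * slV f q w c d n
          - slU f q w c d n * pderiv (slV f q w a b n)"
    unfolding slU_Suc pderiv_add pderiv_smult by (simp add: algebra_simps)
  finally show ?case using Suc by simp
qed

text \<open>A solution that vanishes at the indices 1 and 2 has \<open>v = 0\<close> at index 1;
  running the recursion backwards then gives \<open>b = 0\<close> and \<open>a = 0\<close>. This
  makes the weighted sums of squares strictly positive.\<close>

lemma slU_nontrivial:
  assumes "f 0 \<noteq> 0" "f 1 \<noteq> 0" "(a, b) \<noteq> (0, 0)" "n \<ge> 2"
  shows "\<exists>k\<in>{1..n}. poly (slU f q w a b k) x \<noteq> 0"
proof -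
  have "poly (slU f q w a b 1) x \<noteq> 0 \<or> poly (slU f q w a b 2) x \<noteq> 0"
    using assms by (auto simp: slU_Suc slV_Suc numeral_2_eq_2)
  moreover have "1 \<in> {1..n}" "2 \<in> {1..n}" using assms by auto
  ultimately show ?thesis by blast
qed

section \<open>Degrees and leading coefficients of the initial value polynomials\<close>

lemma slUV_degree_le:
  "degree (slU f q w a b (Suc n)) \<le> n \<and> degree (slV f q w a b (Suc n)) \<le> Suc n"
proof (induction n)
  case 0
  show ?case by (simp add: slU_Suc slV_Suc)
next
  case (Suc n)
  have u: "degree (slU f q w a b (Suc (Suc n))) \<le> Suc n"
    unfolding slU_Suc[of f q w a b "Suc n"] using Suc
    by (intro degree_add_le order.trans[OF degree_smult_le]) auto
  have "degree ([:q (Suc (Suc n)), - w (Suc (Suc n)):] * slU f q w a b (Suc (Suc n))) \<le> 1 + Suc n"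
    by (rule order.trans[OF degree_mult_le] add_mono)+ (use u in auto)
  then show ?case
    using u Suc unfolding slV_Suc[of f q w a b "Suc n"] by (auto intro!: degree_add_le)
qed

text \<open>The top power arises along one path only: from \<open>v\<close> to \<open>u\<close>
  through \<open>1 / f\<close>, and back to \<open>v\<close> through \<open>- w\<close>. The factor
  \<open>f 0 * a + b\<close> is \<open>f 0\<close> times the value of the solution at index
  1.\<close>

lemma coeff_slV_top:
  assumes "f 0 \<noteq> 0"
  shows "coeff (slV f q w a b (Suc n)) (Suc n) =
           (f 0 * a + b) * ((\<Prod>k=1..Suc n. - w k) * (\<Prod>i=0..n. 1 / f i))"
proof (induction n)
  case 0
  then show ?case using assms by (simp add: slU_Suc slV_Suc field_simps)
next
  case (Suc n)
  have z: "coeff (slU f q w a b (Suc n)) (Suc n) = 0" "coeff (slV f q w a b (Suc n)) (Suc (Suc n)) = 0"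
      "coeff (slU f q w a b (Suc (Suc n))) (Suc (Suc n)) = 0"
    using slUV_degree_le[of f q w a b n] slUV_degree_le[of f q w a b "Suc n"]
    by (auto intro: coeff_eq_0)
  have "coeff (slU f q w a b (Suc (Suc n))) (Suc n) = coeff (slV f q w a b (Suc n)) (Suc n) / f (Suc n)"
    unfolding slU_Suc[of f q w a b "Suc n"] using z by simp
  then have "coeff (slV f q w a b (Suc (Suc n))) (Suc (Suc n)) =
      - w (Suc (Suc n)) * (coeff (slV f q w a b (Suc n)) (Suc n) / f (Suc n))"
    unfolding slV_Suc[of f q w a b "Suc n"] using z by simp
  then show ?case unfolding Suc by simp
qed

text \<open>The hypothesis makes the value at index 1 vanish, so \<open>b\<close> passes through the
  first step unchanged. From there on the solution is that of the equation shifted by one index,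
  with data \<open>(0, b)\<close>.\<close>

lemma slUV_shift:
  assumes "f 0 * a + b = 0" "f 0 \<noteq> 0"
  shows "slU f q w a b (Suc n) = slU (\<lambda>n. f (Suc n)) (\<lambda>n. q (Suc n)) (\<lambda>n. w (Suc n)) 0 b n \<and>
         slV f q w a b (Suc n) = slV (\<lambda>n. f (Suc n)) (\<lambda>n. q (Suc n)) (\<lambda>n. w (Suc n)) 0 b n"
proof (induction n)
  case 0
  have "a + b / f 0 = 0" using assms by (simp add: field_simps)
  then show ?case using assms by (simp add: slU_Suc slV_Suc)
next
  case (Suc n)
  have *: "slU f q w a b (Suc (Suc n)) = slU (\<lambda>n. f (Suc n)) (\<lambda>n. q (Suc n)) (\<lambda>n. w (Suc n)) 0 b (Suc n)"
    using Suc by (simp add: slU_Suc[of _ _ _ _ _ "Suc n"] slU_Suc[of "\<lambda>n. f (Suc n)"])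
  show ?case
    using Suc unfolding slV_Suc[of f q w a b "Suc n"] slV_Suc[of "\<lambda>n. f (Suc n)"] *
    by simp
qed

text \<open>In this degenerate case one power of \<lambda> is lost. The new top coefficient is read
  off from the shifted equation, whose products lack the first factors \<open>- w 1\<close> and
  \<open>1 / f 0\<close>.\<close>

lemma coeff_slV_top_shift:
  assumes "f 0 * a + b = 0" "f 0 \<noteq> 0" "f 1 \<noteq> 0"
  shows "degree (slV f q w a b (Suc (Suc n))) \<le> Suc n"
    and "coeff (slV f q w a b (Suc (Suc n))) (Suc n) =
           b * ((\<Prod>k=2..Suc (Suc n). - w k) * (\<Prod>i=1..Suc n. 1 / f i))"
proof -
  show "degree (slV f q w a b (Suc (Suc n))) \<le> Suc n"
    using slUV_shift[of f a b q w "Suc n", OF assms(1,2)] slUV_degree_le[of "\<lambda>n. f (Suc n)" "\<lambda>n. q (Suc n)" "\<lambda>n. w (Suc n)" 0 b n] by simp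
  have w: "(\<Prod>k=2..Suc (Suc n). - w k) = (\<Prod>k=1..Suc n. - w (Suc k))"
    using prod.shift_bounds_cl_Suc_ivl[of "\<lambda>k. - w k" 1 "Suc n"] by (simp only: numeral_2_eq_2 One_nat_def)
  have f: "(\<Prod>i=1..Suc n. 1 / f i) = (\<Prod>i=0..n. 1 / f (Suc i))"
    using prod.shift_bounds_cl_Suc_ivl[of "\<lambda>i. 1 / f i" 0 n] by (simp only: One_nat_def)
  show "coeff (slV f q w a b (Suc (Suc n))) (Suc n) =
           b * ((\<Prod>k=2..Suc (Suc n). - w k) * (\<Prod>i=1..Suc n. 1 / f i))"
    unfolding w f using slUV_shift[of f a b q w "Suc n", OF assms(1,2)]
      coeff_slV_top[of "\<lambda>n. f (Suc n)" "\<lambda>n. q (Suc n)" "\<lambda>n. w (Suc n)" 0 b n] assms(3)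
    by (simp only: One_nat_def) simp
qed

section \<open>Complex values of the parameter\<close>

abbreviation cseq :: "(nat \<Rightarrow> real) \<Rightarrow> nat \<Rightarrow> complex" where
  "cseq f \<equiv> \<lambda>n. complex_of_real (f n)"

lemma poly_slUV_of_real:
  "poly (slU (cseq f) (cseq q) (cseq w) (complex_of_real a) (complex_of_real b) n) (complex_of_real x)
     = of_real (poly (slU f q w a b n) x) \<and>
   poly (slV (cseq f) (cseq q) (cseq w) (complex_of_real a) (complex_of_real b) n) (complex_of_real x)
     = of_real (poly (slV f q w a b n) x)"
proof (induction n)
  case (Suc n)
  have *: "poly (slU (cseq f) (cseq q) (cseq w) (complex_of_real a) (complex_of_real b) (Suc n)) (complex_of_real x)
     = of_real (poly (slU f q w a b (Suc n)) x)"
    using Suc by (simp add: slU_Suc)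
  show ?case using Suc * by (simp add: slV_Suc)
qed simp

text \<open>The solution is paired with its conjugate, which solves the equation for
  \<open>cnj z\<close>. At a zero of \<open>v n\<close> the left side vanishes, and a positive sum
  forces \<open>z\<close> to be real.\<close>

lemma slV_cnj_lagrange:
  fixes z :: complex and f q w :: "nat \<Rightarrow> real" and a b :: real
  defines "u \<equiv> \<lambda>n. poly (slU (cseq f) (cseq q) (cseq w) (of_real a) (of_real b) n) z"
    and "v \<equiv> \<lambda>n. poly (slV (cseq f) (cseq q) (cseq w) (of_real a) (of_real b) n) z"
  shows "u n * cnj (v n) - cnj (u n) * v n = (z - cnj z) * of_real (\<Sum>k=1..n. w k * (cmod (u k))\<^sup>2)"
proof (induction n)
  case 0
  then show ?case by (simp add: u_def v_def)
next
  case (Suc n)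
  have v: "v (Suc n) = v n + (of_real (q (Suc n)) - z * of_real (w (Suc n))) * u (Suc n)"
    by (simp add: u_def v_def slV_Suc algebra_simps)
  have u: "u (Suc n) = u n + v n / of_real (f n)"
    by (simp add: u_def v_def slU_Suc)
  have "u (Suc n) * cnj (v (Suc n)) - cnj (u (Suc n)) * v (Suc n)
      = u (Suc n) * cnj (v n) - cnj (u (Suc n)) * v n
        + (z - cnj z) * of_real (w (Suc n)) * (u (Suc n) * cnj (u (Suc n)))"
    unfolding v by (simp add: algebra_simps)
  also have "u (Suc n) * cnj (v n) - cnj (u (Suc n)) * v n = u n * cnj (v n) - cnj (u n) * v n"
    unfolding u by (simp add: algebra_simps)
  also have "\<dots> = (z - cnj z) * of_real (\<Sum>k=1..n. w k * (cmod (u k))\<^sup>2)" by (rule Suc)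
  also have "u (Suc n) * cnj (u (Suc n)) = of_real ((cmod (u (Suc n)))\<^sup>2)"
    by (metis complex_norm_square)
  finally show ?case by (simp add: algebra_simps)
qed

section \<open>Polynomials with real roots\<close>

lemma sum_weighted_squares_pos:
  fixes w x :: "nat \<Rightarrow> real"
  assumes "\<And>k. k \<in> {1..n} \<Longrightarrow> w k > 0" "k \<in> {1..n}" "x k \<noteq> 0"
  shows "(\<Sum>k=1..n. w k * (x k)\<^sup>2) > 0"
proof (rule sum_pos2[of _ k])
  show "0 \<le> w i * (x i)\<^sup>2" if "i \<in> {1..n}" for i
    using assms(1)[OF that] by simp
qed (use assms in auto)

text \<open>All complex zeros are real by the conjugate Lagrange identity and simple by the Lagrange
  identity, so the fundamental theorem of algebra counts them. Hence the degree in the conclusion is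
  that of the complex polynomial.\<close>

lemma slV_roots_card:
  fixes f q w :: "nat \<Rightarrow> real" and a b :: real
  assumes N2: "N \<ge> 2" and f: "f 0 \<noteq> 0" "f 1 \<noteq> 0"
    and w: "\<And>k. k \<in> {1..N} \<Longrightarrow> w k > 0" and ab: "(a, b) \<noteq> (0, 0)"
  shows "card {x. poly (slV f q w a b N) x = 0} =
    degree (slV (cseq f) (cseq q) (cseq w) (of_real a) (of_real b) N)"
proof -
  define G where "G = slV (cseq f) (cseq q) (cseq w) (of_real a) (of_real b) N"
  define u where "u = (\<lambda>k. slU (cseq f) (cseq q) (cseq w) (of_real a) (of_real b) k)"
  have nontriv: "\<exists>k\<in>{1..N}. poly (u k) z \<noteq> 0" for z
  proof -
    have "(complex_of_real a, complex_of_real b) \<noteq> (0, 0)" using ab by simp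
    then show ?thesis
      using f N2 unfolding u_def by (intro slU_nontrivial) auto
  qed
  have real_root: "z \<in> \<real>" if "poly G z = 0" for z
  proof -
    obtain k where "k \<in> {1..N}" "cmod (poly (u k) z) \<noteq> 0" using nontriv[of z] by auto
    then have "(\<Sum>k=1..N. w k * (cmod (poly (u k) z))\<^sup>2) > 0"
      using w by (intro sum_weighted_squares_pos) auto
    then have "z - cnj z = 0"
      using slV_cnj_lagrange[of f q w a b N z] that unfolding G_def u_def
      by (simp del: of_real_sum)
    then show ?thesis by (simp add: Reals_cnj_iff)
  qed
  have rsq: "rsquarefree G"
    unfolding rsquarefree_roots
  proof (intro allI notI, elim conjE)
    fix z assume z: "poly G z = 0" "poly (pderiv G) z = 0"
    then obtain x where x: "z = of_real x" using real_root by (auto elim: Reals_cases)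
    obtain k where "k \<in> {1..N}" "poly (slU f q w a b k) x \<noteq> 0"
      using nontriv[of z] poly_slUV_of_real[of f q w a b _ x] unfolding x u_def by auto
    then have "(\<Sum>k=1..N. w k * (poly (slU f q w a b k) x)\<^sup>2) > 0"
      using w by (intro sum_weighted_squares_pos) auto
    \<comment> \<open>At a double zero both terms on the left of the Lagrange identity vanish, which
      contradicts the positivity just shown.\<close>
    moreover have "complex_of_real (\<Sum>k=1..N. w k * (poly (slU f q w a b k) x)\<^sup>2) = 0"
    proof -
      have "complex_of_real (\<Sum>k=1..N. w k * (poly (slU f q w a b k) x)\<^sup>2) =
         poly (\<Sum>k=1..N. smult (cseq w k) (u k * u k)) z"
        unfolding u_def x by (simp add: poly_sum poly_slUV_of_real power2_eq_square)
      also have "\<dots> = poly (pderiv (u N)) z * poly G z - poly (u N) z * poly (pderiv G) z"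
        unfolding u_def G_def slUV_lagrange[symmetric] by simp
      finally show ?thesis using z by simp
    qed
    ultimately show False by (simp del: of_real_sum)
  qed
  then have "G \<noteq> 0" by (simp add: rsquarefree_def)
  have "proots G = mset_set {z. poly G z = 0}"
  proof (rule multiset_eqI)
    fix z
    show "count (proots G) z = count (mset_set {z. poly G z = 0}) z"
      using rsquarefree_root_order[OF rsq, of z] \<open>G \<noteq> 0\<close> poly_roots_finite[of G]
      by (cases "poly G z = 0") (auto simp: count_mset_set' order_root)
  qed
  then have "card {z. poly G z = 0} = degree G"
    by (metis size_mset_set size_proots_complex)
  moreover have "{z. poly G z = 0} = of_real ` {x. poly (slV f q w a b N) x = 0}"
  proof -
    have G: "poly G (of_real x) = of_real (poly (slV f q w a b N) x)" for x
      unfolding G_def using poly_slUV_of_real[of f q w a b N x] by simp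
    show ?thesis
    proof (intro equalityI subsetI)
      fix z assume z: "z \<in> {z. poly G z = 0}"
      then obtain x where "z = of_real x" using real_root[of z] by (auto elim: Reals_cases)
      then show "z \<in> of_real ` {x. poly (slV f q w a b N) x = 0}" using z G by auto
    qed (use G in auto)
  qed
  ultimately show ?thesis
    unfolding G_def by (simp add: card_image inj_on_def)
qed

text \<open>The third property holds because the sign of the derivative at a simple real root is
  fixed by the leading coefficient and by the number \<open>degree g - Suc j\<close> of roots to its
  right.\<close>

lemma simple_roots_enum:
  fixes g :: "real poly"
  assumes g0: "g \<noteq> 0" and card: "card {x. poly g x = 0} = degree g"
  obtains \<nu> :: "nat \<Rightarrow> real"
  where "\<And>i j. i < j \<Longrightarrow> j < degree g \<Longrightarrow> \<nu> i < \<nu> j"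
    and "\<And>x. poly g x = 0 \<longleftrightarrow> (\<exists>j<degree g. \<nu> j = x)"
    and "\<And>j. j < degree g \<Longrightarrow>
          0 < (-1) ^ (degree g - Suc j) * lead_coeff g * poly (pderiv g) (\<nu> j)"
proof -
  define d where "d = degree g"
  define R where "R = {x. poly g x = 0}"
  define \<nu> where "\<nu> = (\<lambda>j. sorted_list_of_set R ! j)"
  have fin: "finite R" unfolding R_def using g0 by (rule poly_roots_finite)
  have len: "length (sorted_list_of_set R) = d"
    using card by (simp add: R_def d_def)
  have mono: "\<nu> i < \<nu> j" if "i < j" "j < d" for i j
    unfolding \<nu>_def using that strict_sorted_list_of_set[of R] len
    by (auto simp: sorted_wrt_iff_nth_less)
  have inj: "inj_on \<nu> {..<d}"
    by (rule inj_onI) (metis lessThan_iff linorder_neqE_nat mono order_less_irrefl)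
  have range: "\<nu> ` {..<d} = R"
    using len fin nth_image[of d "sorted_list_of_set R"] unfolding \<nu>_def
    by (simp add: lessThan_atLeast0 image_def[symmetric])
  define h where "h = smult (lead_coeff g) (\<Prod>i<d. [:- \<nu> i, 1:])"
  have degh: "degree (\<Prod>i<d. [:- \<nu> i, 1:]) = d"
    by (subst degree_prod_sum_eq) auto
  have lch: "coeff (\<Prod>i<d. [:- \<nu> i, 1:]) d = 1"
    using lead_coeff_prod[of "\<lambda>i. [:- \<nu> i, 1:]" "{..<d}"] degh by simp
  \<comment> \<open>Two polynomials of degree at most \<open>d\<close> with the same coefficient at
    \<open>d\<close> and the same values at \<open>d\<close> points coincide.\<close>
  have "g = h"
  proof (rule poly_eqI_degree_lead_coeff[where A = R and n = d])
    show "coeff g d = coeff h d" using lch by (simp add: h_def d_def)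
    show "card R \<ge> d" using card by (simp add: R_def d_def)
    show "degree g \<le> d" by (simp add: d_def)
    show "degree h \<le> d" unfolding h_def using degh by simp
    show "poly g x = poly h x" if "x \<in> R" for x
    proof -
      have "poly h x = 0"
        using that unfolding range[symmetric] h_def by (auto simp: poly_prod)
      then show ?thesis using that by (simp add: R_def)
    qed
  qed
  have sq: "((-1) ^ n)\<^sup>2 = (1::real)" for n :: nat
    by (metis power_minus1_even power_even_eq)
  have rearrange: "s * l * (l * p) = l\<^sup>2 * (A * B)" if "p = A * (s * B)" "s\<^sup>2 = 1" for s l p A B :: real
    using that by algebra
  have "0 < (-1) ^ (d - Suc j) * lead_coeff g * poly (pderiv g) (\<nu> j)" if j: "j < d" for j
  proof -
    define r where "r = (\<Prod>i\<in>{..<d} - {j}. [:- \<nu> i, 1:])"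
    have "(\<Prod>i<d. [:- \<nu> i, 1:]) = [:- \<nu> j, 1:] * r"
      unfolding r_def using j by (subst prod.remove[of _ j]) auto
    then have "g = smult (lead_coeff g) ([:- \<nu> j, 1:] * r)" using \<open>g = h\<close> h_def by simp
    then have "pderiv g = smult (lead_coeff g) ([:- \<nu> j, 1:] * pderiv r + r)"
      using pderiv_smult[of "lead_coeff g" "[:- \<nu> j, 1:] * r"]
        pderiv_mult[of "[:- \<nu> j, 1:]" r] by (simp add: pderiv_pCons)
    then have der: "poly (pderiv g) (\<nu> j) = lead_coeff g * poly r (\<nu> j)" by simp
    have split: "{..<d} - {j} = {..<j} \<union> {Suc j..<d}" using j by auto
    \<comment> \<open>Differences to the roots on the left are positive; each root on the right
      contributes one minus sign.\<close>
    have "poly r (\<nu> j) = (\<Prod>i<j. \<nu> j - \<nu> i) * (\<Prod>i=Suc j..<d. \<nu> j - \<nu> i)"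
      unfolding r_def split by (subst prod.union_disjoint) (auto simp: poly_prod)
    also have "(\<Prod>i=Suc j..<d. \<nu> j - \<nu> i) = (-1) ^ (d - Suc j) * (\<Prod>i=Suc j..<d. \<nu> i - \<nu> j)"
      using prod.distrib[of "\<lambda>_. -1" "\<lambda>i. \<nu> i - \<nu> j" "{Suc j..<d}"] by simp
    finally have "(-1) ^ (d - Suc j) * lead_coeff g * poly (pderiv g) (\<nu> j) =
       (lead_coeff g)\<^sup>2 * ((\<Prod>i<j. \<nu> j - \<nu> i) * (\<Prod>i=Suc j..<d. \<nu> i - \<nu> j))"
      unfolding der using sq[of "d - Suc j"] by (intro rearrange)
    also have "\<dots> > 0"
      using g0 mono j by (intro mult_pos_pos prod_pos) auto
    finally show ?thesis .
  qed
  then show ?thesis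
  proof (intro that[of \<nu>])
    show "poly g x = 0 \<longleftrightarrow> (\<exists>j<degree g. \<nu> j = x)" for x
    proof -
      have "poly g x = 0 \<longleftrightarrow> x \<in> \<nu> ` {..<degree g}"
        using range by (simp add: d_def R_def)
      then show ?thesis by auto
    qed
  qed (use mono in \<open>auto simp: d_def\<close>)
qed

text \<open>Here \<alpha> is the last point of the interval with \<open>E \<ge> c\<close> and
  \<beta> the first point after it with \<open>E \<le> - c\<close>. The intermediate value theorem
  and this extremality turn both inequalities into equalities.\<close>

lemma crossing_interval:
  fixes E :: "real \<Rightarrow> real"
  assumes cont: "continuous_on {a..b} E" and ab: "a \<le> b" and E: "E a \<ge> c" "E b \<le> - c" "c > 0"
  shows "\<exists>\<alpha> \<beta>. a \<le> \<alpha> \<and> \<alpha> < \<beta> \<and> \<beta> \<le> b \<and> E \<alpha> = c \<and> E \<beta> = - c \<and> (\<forall>x. \<alpha> < x \<and> x < \<beta> \<longrightarrow> \<bar>E x\<bar> < c)"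
proof -
  define S where "S = {a..b} \<inter> E -` {c..}"
  have "closed S" unfolding S_def by (rule continuous_closed_preimage[OF cont]) auto
  then have "compact S" unfolding compact_eq_bounded_closed S_def
    by (auto intro: bounded_subset[of "{a..b}"])
  moreover have "a \<in> S" using ab E by (simp add: S_def)
  ultimately obtain \<alpha> where \<alpha>: "\<alpha> \<in> S" "\<And>x. x \<in> S \<Longrightarrow> x \<le> \<alpha>"
    using compact_attains_sup[of S] by auto
  have E\<alpha>: "E \<alpha> = c"
  proof -
    obtain x where "\<alpha> \<le> x" "x \<le> b" "E x = c"
      using IVT2'[of E b c \<alpha>] \<alpha> E continuous_on_subset[OF cont, of "{\<alpha>..b}"]
      by (auto simp: S_def)
    then show ?thesis using \<alpha>(1) \<alpha>(2)[of x] by (auto simp: S_def)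
  qed
  define T where "T = {\<alpha>..b} \<inter> E -` {..- c}"
  have cont': "continuous_on {\<alpha>..b} E"
    using \<alpha> by (intro continuous_on_subset[OF cont]) (auto simp: S_def)
  have "closed T" unfolding T_def by (rule continuous_closed_preimage[OF cont']) auto
  then have "compact T" unfolding compact_eq_bounded_closed T_def
    by (auto intro: bounded_subset[of "{\<alpha>..b}"])
  moreover have "b \<in> T" using \<alpha> E by (simp add: T_def S_def)
  ultimately obtain \<beta> where \<beta>: "\<beta> \<in> T" "\<And>x. x \<in> T \<Longrightarrow> \<beta> \<le> x"
    using compact_attains_inf[of T] by auto
  have E\<beta>: "E \<beta> = - c"
  proof -
    obtain x where "\<alpha> \<le> x" "x \<le> \<beta>" "E x = - c"
      using IVT2'[of E \<beta> "- c" \<alpha>] \<beta> E E\<alpha> continuous_on_subset[OF cont', of "{\<alpha>..\<beta>}"]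
      by (auto simp: T_def)
    then show ?thesis using \<beta>(1) \<beta>(2)[of x] by (auto simp: T_def)
  qed
  have "\<alpha> \<noteq> \<beta>" using E\<alpha> E\<beta> E by auto
  moreover have "\<bar>E x\<bar> < c" if "\<alpha> < x" "x < \<beta>" for x
  proof -
    have "\<not> c \<le> E x" "\<not> E x \<le> - c"
      using \<alpha>(1) \<alpha>(2)[of x] \<beta>(1) \<beta>(2)[of x] that by (auto simp: S_def T_def)
    then show ?thesis by linarith
  qed
  ultimately show ?thesis
    using \<alpha>(1) \<beta>(1) E\<alpha> E\<beta> by (intro exI[of _ \<alpha>] exI[of _ \<beta>]) (auto simp: S_def T_def)
qed

text \<open>On each interval from \<open>t j\<close> to \<open>t (Suc j)\<close>,
  \<open>crossing_interval\<close> is applied to \<open>(-1) ^ j\<close> times \<open>D\<close>; the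
  alternating signs at the nodes supply its two boundary inequalities.\<close>

lemma poly_bands:
  fixes D :: "real poly"
  assumes t: "\<And>i j. i < j \<Longrightarrow> j \<le> N \<Longrightarrow> t i < t j"
    and s: "\<And>j. j \<le> N \<Longrightarrow> (-1) ^ j * poly D (t j) \<ge> 2"
  obtains \<alpha> \<beta> where
    "\<And>j. j < N \<Longrightarrow> t j \<le> \<alpha> j" "\<And>j. j < N \<Longrightarrow> \<alpha> j < \<beta> j" "\<And>j. j < N \<Longrightarrow> \<beta> j \<le> t (Suc j)"
    "\<And>j. j < N \<Longrightarrow> poly D (\<alpha> j) = 2 * (-1) ^ j" "\<And>j. j < N \<Longrightarrow> poly D (\<beta> j) = - 2 * (-1) ^ j"
    "\<And>j x. j < N \<Longrightarrow> \<alpha> j < x \<Longrightarrow> x < \<beta> j \<Longrightarrow> \<bar>poly D x\<bar> < 2"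
proof -
  have sq: "(-1) ^ j * (-1) ^ j = (1::real)" for j :: nat by (metis power2_eq_square power_even_eq power_minus1_even)
  define Q where "Q = (\<lambda>j \<alpha> \<beta>. t j \<le> \<alpha> \<and> \<alpha> < \<beta> \<and> \<beta> \<le> t (Suc j) \<and>
     poly D \<alpha> = 2 * (-1) ^ j \<and> poly D \<beta> = - 2 * (-1) ^ j \<and>
     (\<forall>x. \<alpha> < x \<and> x < \<beta> \<longrightarrow> \<bar>poly D x\<bar> < 2))"
  have "\<exists>\<alpha> \<beta>. j < N \<longrightarrow> Q j \<alpha> \<beta>" for j
  proof (cases "j < N")
    case True
    have "\<exists>\<alpha> \<beta>. t j \<le> \<alpha> \<and> \<alpha> < \<beta> \<and> \<beta> \<le> t (Suc j) \<and> (-1) ^ j * poly D \<alpha> = 2 \<and> (-1) ^ j * poly D \<beta> = - 2 \<and>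
        (\<forall>x. \<alpha> < x \<and> x < \<beta> \<longrightarrow> \<bar>(-1) ^ j * poly D x\<bar> < 2)"
      using t[of j "Suc j"] s[of j] s[of "Suc j"] True
      by (intro crossing_interval continuous_intros) auto
    then obtain \<alpha> \<beta> where ab: "t j \<le> \<alpha>" "\<alpha> < \<beta>" "\<beta> \<le> t (Suc j)" "(-1) ^ j * poly D \<alpha> = 2"
        "(-1) ^ j * poly D \<beta> = - 2" "\<And>x. \<alpha> < x \<Longrightarrow> x < \<beta> \<Longrightarrow> \<bar>(-1) ^ j * poly D x\<bar> < 2" by blast
    have "(-1) ^ j * ((-1) ^ j * poly D \<alpha>) = poly D \<alpha>" "(-1) ^ j * ((-1) ^ j * poly D \<beta>) = poly D \<beta>"
      using sq[of j] by (simp_all flip: mult.assoc)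
    then have "poly D \<alpha> = 2 * (-1) ^ j" "poly D \<beta> = - 2 * (-1) ^ j"
      using ab(4,5) by simp_all
    then show ?thesis
      using ab(1-3,6) by (intro exI[of _ \<alpha>] exI[of _ \<beta>]) (auto simp: Q_def abs_mult power_abs)
  qed auto
  then obtain \<alpha> \<beta> where "\<And>j. j < N \<Longrightarrow> Q j (\<alpha> j) (\<beta> j)" by metis
  then show ?thesis by (intro that[of \<alpha> \<beta>]) (auto simp: Q_def)
qed

text \<open>Lower bounds on the orders suffice: the multiset of the \<open>N\<close> values of \<mu>
  lies inside the root multiset of \<open>p\<close>, which has at most \<open>N\<close> elements, so
  the two agree and no other root exists.\<close>

lemma order_eq_card_roots:
  fixes p :: "real poly" and \<mu> :: "nat \<Rightarrow> real"
  assumes p: "p \<noteq> 0" "degree p \<le> N"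
    and le: "\<And>j. j < N \<Longrightarrow> card {i. i < N \<and> \<mu> i = \<mu> j} \<le> order (\<mu> j) p"
  shows "order x p = card {j. j < N \<and> \<mu> j = x}"
proof -
  define A where "A = image_mset \<mu> (mset_set {..<N})"
  have count: "count A x = card {j. j < N \<and> \<mu> j = x}" for x
    unfolding A_def count_image_mset
    by (auto simp: vimage_def Int_def conj_commute sum.If_cases intro!: arg_cong[of _ _ card])
  have "A \<subseteq># proots p"
  proof (rule mset_subset_eqI)
    fix x
    show "count A x \<le> count (proots p) x"
    proof (cases "\<exists>j<N. \<mu> j = x")
      case True then show ?thesis using le count p by auto
    next
      case False
      then have "{j. j < N \<and> \<mu> j = x} = {}" by blast
      then show ?thesis unfolding count by (metis card.empty zero_le)
    qed
  qed
  moreover have "size (proots p) \<le> size A"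
    using size_proots_le[of p] p by (simp add: A_def)
  ultimately have "proots p = A"
    using mset_subset_size subset_mset.le_neq_trans by fastforce
  then show ?thesis using count[of x] count_proots[OF p(1), of x] by simp
qed

section \<open>Eigenvalues and multiplicities\<close>

text \<open>With matching multiplicities, \<open>sl_count\<close> at \<open>x\<close> is the number
  of indices with \<open>\<mu> i \<le> x\<close>. By monotonicity this exceeds \<open>j\<close>
  exactly for \<open>x \<ge> \<mu> j\<close>, so the infimum is \<open>\<mu> j\<close>.\<close>

lemma sl_eig_eqI:
  assumes mono: "\<And>i j. i \<le> j \<Longrightarrow> j < n \<Longrightarrow> \<mu> i \<le> \<mu> j"
    and mult: "\<And>x. sl_mult f q w N bc (complex_of_real x) = card {j. j < n \<and> \<mu> j = x}"
    and eig: "\<And>x. sl_is_eig f q w N bc (complex_of_real x) \<longleftrightarrow> (\<exists>j<n. \<mu> j = x)"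
    and j: "j < n"
  shows "sl_eig f q w N bc j = \<mu> j"
proof -
  have count: "sl_count f q w N bc x = card {i. i < n \<and> \<mu> i \<le> x}" for x
  proof -
    define Y where "Y = {y. (\<exists>i<n. \<mu> i = y) \<and> y \<le> x}"
    have "finite Y" unfolding Y_def by (rule finite_subset[of _ "\<mu> ` {..<n}"]) auto
    have "sl_count f q w N bc x = (\<Sum>y\<in>Y. card {i. i < n \<and> \<mu> i = y})"
      unfolding sl_count_def eig mult Y_def ..
    also have "\<dots> = card (\<Union>y\<in>Y. {i. i < n \<and> \<mu> i = y})"
      using \<open>finite Y\<close> by (intro card_UN_disjoint[symmetric]) auto
    also have "(\<Union>y\<in>Y. {i. i < n \<and> \<mu> i = y}) = {i. i < n \<and> \<mu> i \<le> x}"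
      unfolding Y_def by auto
    finally show ?thesis .
  qed
  have "j < card {i. i < n \<and> \<mu> i \<le> x} \<longleftrightarrow> \<mu> j \<le> x" for x
  proof
    assume "\<mu> j \<le> x"
    then have "{..j} \<subseteq> {i. i < n \<and> \<mu> i \<le> x}" using mono[of _ j] j by force
    then have "card {..j} \<le> card {i. i < n \<and> \<mu> i \<le> x}" by (intro card_mono) auto
    then show "j < card {i. i < n \<and> \<mu> i \<le> x}" by simp
  next
    assume *: "j < card {i. i < n \<and> \<mu> i \<le> x}"
    show "\<mu> j \<le> x"
    proof (rule ccontr)
      assume "\<not> \<mu> j \<le> x"
      then have "{i. i < n \<and> \<mu> i \<le> x} \<subseteq> {..<j}"
        using mono[of j] by (force simp: not_less[symmetric])
      then have "card {i. i < n \<and> \<mu> i \<le> x} \<le> card {..<j}" by (intro card_mono) auto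
      then show False using * by simp
    qed
  qed
  then have "{x. j < sl_count f q w N bc x} = {\<mu> j..}" unfolding count by auto
  then show ?thesis unfolding sl_eig_def by simp
qed

lemma sl_eig_simple:
  assumes "\<And>i j. i < j \<Longrightarrow> j < n \<Longrightarrow> \<nu> i < \<nu> j"
    and "\<And>x. P x \<longleftrightarrow> (\<exists>j<n. \<nu> j = x)"
    and "\<And>x. sl_mult f q w N bc (complex_of_real x) = (if P x then 1 else 0)"
    and "\<And>x. sl_is_eig f q w N bc (complex_of_real x) \<longleftrightarrow> P x"
    and "j < n"
  shows "sl_eig f q w N bc j = \<nu> j"
proof (rule sl_eig_eqI)
  show "\<nu> i \<le> \<nu> j" if "i \<le> j" "j < n" for i j
    using assms(1)[of i j] that by (cases "i = j") auto
  show "sl_mult f q w N bc (complex_of_real x) = card {j. j < n \<and> \<nu> j = x}" for x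
  proof (cases "P x")
    case True
    then obtain k where k: "k < n" "\<nu> k = x" using assms(2) by blast
    have "{j. j < n \<and> \<nu> j = x} = {k}"
    proof -
      have "j = k" if "j < n" "\<nu> j = \<nu> k" for j
        using assms(1)[of j k] assms(1)[of k j] that k by (cases j k rule: linorder_cases) auto
      then show ?thesis unfolding k(2)[symmetric] using k(1) by blast
    qed
    then show ?thesis using True assms(3) by simp
  next
    case False
    then have "{j. j < n \<and> \<nu> j = x} = {}" using assms(2) by blast
    then show ?thesis using False assms(3) by (metis card.empty)
  qed
qed (use assms in auto)

section \<open>The solution space and its dimension\<close>

interpretation seq_vs: vector_space seq_scale
  by unfold_locales (auto simp: seq_scale_def fun_eq_iff algebra_simps)

text \<open>The general solution at a real parameter: complex initial data applied to the two real
  fundamental solutions. It is cut off after index \<open>N + 1\<close> to agree with the convention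
  of \<open>sl_sol_space\<close>.\<close>

definition sl_seq ::
  "(nat \<Rightarrow> real) \<Rightarrow> (nat \<Rightarrow> real) \<Rightarrow> (nat \<Rightarrow> real) \<Rightarrow> nat \<Rightarrow> real \<Rightarrow> complex \<Rightarrow> complex \<Rightarrow> nat \<Rightarrow> complex"
where
  "sl_seq f q w N x a b n =
     (if n \<le> Suc N then a * of_real (poly (slU f q w 1 0 n) x) + b * of_real (poly (slU f q w 0 1 n) x)
      else 0)"

lemma sl_seq_eq_0_iff:
  assumes "f 0 \<noteq> 0"
  shows "sl_seq f q w N x a b = 0 \<longleftrightarrow> a = 0 \<and> b = 0"
proof
  assume "sl_seq f q w N x a b = 0"
  then have "sl_seq f q w N x a b 0 = 0" "sl_seq f q w N x a b 1 = 0" by simp_all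
  then show "a = 0 \<and> b = 0" using assms by (simp add: sl_seq_def slU_Suc)
qed (simp add: fun_eq_iff sl_seq_def)

lemma sl_seq_scale: "sl_seq f q w N x (k * a) (k * b) = seq_scale k (sl_seq f q w N x a b)"
  by (auto simp: sl_seq_def seq_scale_def fun_eq_iff algebra_simps)

lemma sl_seq_step:
  assumes f: "\<And>n. n \<le> N \<Longrightarrow> f n \<noteq> 0" and n: "n \<le> N"
  shows "of_real (f n) * (sl_seq f q w N x a b (Suc n) - sl_seq f q w N x a b n) =
    a * of_real (poly (slV f q w 1 0 n) x) + b * of_real (poly (slV f q w 0 1 n) x)"
  using assms by (simp add: sl_seq_def slU_Suc field_simps)

text \<open>Since no \<open>f n\<close> vanishes, the equation determines a solution from its data
  at index 0. The boundary condition thereby becomes a condition \<open>B\<close> on these data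
  alone.\<close>

lemma sl_sol_space_eq:
  assumes f: "\<And>n. n \<le> N \<Longrightarrow> f n \<noteq> 0"
    and bc: "\<And>a b. fst bc *v vector [a, b] + snd bc *v vector
         [a * of_real (poly (slU f q w 1 0 N) x) + b * of_real (poly (slU f q w 0 1 N) x),
          a * of_real (poly (slV f q w 1 0 N) x) + b * of_real (poly (slV f q w 0 1 N) x)] = 0 \<longleftrightarrow> B a b"
  shows "sl_sol_space f q w N bc (of_real x) = {sl_seq f q w N x a b |a b. B a b}"
proof (intro equalityI subsetI)
  fix y assume y: "y \<in> sl_sol_space f q w N bc (of_real x)"
  define a where "a = y 0"
  define b where "b = of_real (f 0) * (y 1 - y 0)"
  have eq: "- (of_real (f n) * (y (Suc n) - y n) - of_real (f (n-1)) * (y n - y (n-1)))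
            + of_real (q n) * y n = of_real x * of_real (w n) * y n" if "n \<in> {1..N}" for n
    using y that by (simp add: sl_sol_space_def)
  have *: "y n = sl_seq f q w N x a b n \<and>
     of_real (f n) * (y (Suc n) - y n) =
       a * of_real (poly (slV f q w 1 0 n) x) + b * of_real (poly (slV f q w 0 1 n) x)" if "n \<le> N" for n
    using that
  proof (induction n)
    case 0
    then show ?case by (simp add: a_def b_def sl_seq_def)
  next
    case (Suc n)
    have fn: "f n \<noteq> 0" using f Suc by simp
    have "y (Suc n) = y n + (of_real (f n) * (y (Suc n) - y n)) / of_real (f n)" using fn by simp
    also have "\<dots> = sl_seq f q w N x a b (Suc n)"
      using Suc by (simp add: sl_seq_def slU_Suc add_divide_distrib algebra_simps)
    finally have yS: "y (Suc n) = sl_seq f q w N x a b (Suc n)" .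
    have "of_real (f (Suc n)) * (y (Suc (Suc n)) - y (Suc n)) =
        of_real (f n) * (y (Suc n) - y n) + (of_real (q (Suc n)) - of_real x * of_real (w (Suc n))) * y (Suc n)"
      using eq[of "Suc n"] Suc.prems by (simp add: algebra_simps)
    also have "\<dots> = a * of_real (poly (slV f q w 1 0 n) x) + b * of_real (poly (slV f q w 0 1 n) x)
       + (of_real (q (Suc n)) - of_real x * of_real (w (Suc n))) *
       (a * of_real (poly (slU f q w 1 0 (Suc n)) x) + b * of_real (poly (slU f q w 0 1 (Suc n)) x))"
      using Suc yS by (auto simp: sl_seq_def)
    also have "\<dots> = a * of_real (poly (slV f q w 1 0 (Suc n)) x) + b * of_real (poly (slV f q w 0 1 (Suc n)) x)"
      by (simp add: slV_Suc algebra_simps)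
    finally show ?case using yS by simp
  qed
  have "y n = sl_seq f q w N x a b n" for n
  proof -
    \<comment> \<open>The induction stops at \<open>N\<close>; the value at \<open>N + 1\<close> is
      recovered from the difference at \<open>N\<close>, because \<open>f N\<close> is
      nonzero.\<close>
    consider "n \<le> N" | "n = Suc N" | "n > Suc N" by linarith
    then show ?thesis
    proof cases
      case 2
      have "of_real (f N) * (y (Suc N) - y N) =
          of_real (f N) * (sl_seq f q w N x a b (Suc N) - sl_seq f q w N x a b N)"
        using sl_seq_step[of N f N q w x a b] f *[of N] by auto
      then show ?thesis using 2 f[of N] *[of N] by simp
    qed (use * y in \<open>auto simp: sl_seq_def sl_sol_space_def\<close>)
  qed
  then have "y = sl_seq f q w N x a b" by blast
  moreover have "B a b"
  proof -
    have "fst bc *v vector [y 0, of_real (f 0) * (y 1 - y 0)]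
         + snd bc *v vector [y N, of_real (f N) * (y (Suc N) - y N)] = 0"
      using y by (simp add: sl_sol_space_def)
    moreover have yN: "y N = a * of_real (poly (slU f q w 1 0 N) x) + b * of_real (poly (slU f q w 0 1 N) x)"
      "of_real (f N) * (y (Suc N) - y N) =
        a * of_real (poly (slV f q w 1 0 N) x) + b * of_real (poly (slV f q w 0 1 N) x)"
      using *[of N] by (auto simp: sl_seq_def)
    ultimately show ?thesis
      unfolding bc[symmetric] yN(2) unfolding yN(1) b_def[symmetric] unfolding a_def[symmetric] by simp
  qed
  ultimately show "y \<in> {sl_seq f q w N x a b |a b. B a b}" by blast
next
  fix y assume "y \<in> {sl_seq f q w N x a b |a b. B a b}"
  then obtain a b where y: "y = sl_seq f q w N x a b" and "B a b" by blast
  have step: "of_real (f n) * (y (Suc n) - y n) =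
      a * of_real (poly (slV f q w 1 0 n) x) + b * of_real (poly (slV f q w 0 1 n) x)" if "n \<le> N" for n
    unfolding y by (rule sl_seq_step) (use f that in auto)
  have val: "y n = a * of_real (poly (slU f q w 1 0 n) x) + b * of_real (poly (slU f q w 0 1 n) x)"
    if "n \<le> Suc N" for n
    using that by (simp add: y sl_seq_def)
  have "- (of_real (f n) * (y (Suc n) - y n) - of_real (f (n-1)) * (y n - y (n-1)))
            + of_real (q n) * y n = of_real x * of_real (w n) * y n" if n: "n \<in> {1..N}" for n
  proof -
    obtain m where m: "n = Suc m" using n by (cases n) auto
    show ?thesis
      using n step[of n] step[of m] val[of n] by (simp add: m slV_Suc algebra_simps)
  qed
  moreover have "fst bc *v vector [y 0, of_real (f 0) * (y 1 - y 0)]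
         + snd bc *v vector [y N, of_real (f N) * (y (Suc N) - y N)] = 0"
    using step[of 0] step[of N] val[of 0] val[of N] \<open>B a b\<close> bc[of a b] by simp
  ultimately show "y \<in> sl_sol_space f q w N bc (of_real x)"
    by (simp add: sl_sol_space_def) (simp add: y sl_seq_def)
qed

text \<open>A vector annihilated by a nonzero row spans the kernel, since the vanishing determinant
  makes the other row proportional to it.\<close>

lemma kernel_2x2_line:
  fixes t11 t12 t21 t22 :: "'a::field"
  assumes "t11 * t22 - t12 * t21 = 0" "\<not> (t11 = 0 \<and> t12 = 0 \<and> t21 = 0 \<and> t22 = 0)"
  obtains a b where "(a, b) \<noteq> (0, 0)"
    "\<And>c d. t11 * c + t12 * d = 0 \<and> t21 * c + t22 * d = 0 \<longleftrightarrow> (\<exists>k. c = k * a \<and> d = k * b)"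
proof -
  have line: "(\<exists>k. c = k * s \<and> d = k * (- r)) \<longleftrightarrow> r * c + s * d = 0" if "(r, s) \<noteq> (0, 0)" for r s c d :: 'a
  proof (cases "s = 0")
    case True
    then show ?thesis using that by (auto intro: exI[of _ "- d / r"])
  next
    case False
    show ?thesis
    proof
      assume "r * c + s * d = 0"
      then have "d * s = - (c * r)" by (simp add: eq_neg_iff_add_eq_0 algebra_simps)
      then show "\<exists>k. c = k * s \<and> d = k * (- r)"
        using False by (intro exI[of _ "c / s"]) (simp add: field_simps)
    qed (auto simp: algebra_simps)
  qed
  show ?thesis
  proof (cases "(t11, t12) = (0, 0)")
    case True
    then show ?thesis using assms line[of t21 t22] by (intro that[of t22 "- t21"]) auto
  next
    case False
    have "t21 * c + t22 * d = 0" if "t11 * c + t12 * d = 0" for c d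
    proof -
      have "t11 * (t21 * c + t22 * d) = 0" "t12 * (t21 * c + t22 * d) = 0"
        using that assms(1) by algebra+
      then show ?thesis using False by auto
    qed
    then show ?thesis using False line[of t11 t12] by (intro that[of t12 "- t11"]) auto
  qed
qed

text \<open>Initial data map linearly and injectively to sequences, so the multiplicity is the
  nullity of the 2x2 matrix \<open>t\<close> that expresses the boundary condition.\<close>

lemma sl_mult_cases:
  assumes f: "\<And>n. n \<le> N \<Longrightarrow> f n \<noteq> 0"
    and bc: "\<And>a b. fst bc *v vector [a, b] + snd bc *v vector
         [a * of_real (poly (slU f q w 1 0 N) x) + b * of_real (poly (slU f q w 0 1 N) x),
          a * of_real (poly (slV f q w 1 0 N) x) + b * of_real (poly (slV f q w 0 1 N) x)] = 0 \<longleftrightarrow>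
         t11 * a + t12 * b = 0 \<and> t21 * a + t22 * b = 0"
  shows "sl_mult f q w N bc (of_real x) =
       (if t11 * t22 - t12 * t21 \<noteq> 0 then 0
        else if t11 = 0 \<and> t12 = 0 \<and> t21 = 0 \<and> t22 = 0 then 2 else 1)" (is ?mult)
    and "sl_is_eig f q w N bc (of_real x) \<longleftrightarrow> t11 * t22 - t12 * t21 = 0" (is ?eig)
proof -
  have space: "sl_sol_space f q w N bc (of_real x) =
      {sl_seq f q w N x a b |a b. t11 * a + t12 * b = 0 \<and> t21 * a + t22 * b = 0}"
    by (intro sl_sol_space_eq f bc)
  let ?S = "sl_sol_space f q w N bc (of_real x)"
  let ?s = "sl_seq f q w N x"
  have f0: "f 0 \<noteq> 0" using f by simp
  consider (regular) "t11 * t22 - t12 * t21 \<noteq> 0"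
    | (line) "t11 * t22 - t12 * t21 = 0" "\<not> (t11 = 0 \<and> t12 = 0 \<and> t21 = 0 \<and> t22 = 0)"
    | (plane) "t11 = 0 \<and> t12 = 0 \<and> t21 = 0 \<and> t22 = 0" by blast
  then have "?mult \<and> ?eig"
  proof cases
    case regular
    have ker: "a = 0 \<and> b = 0" if "t11 * a + t12 * b = 0" "t21 * a + t22 * b = 0" for a b
    proof -
      have "(t11 * t22 - t12 * t21) * a = 0" "(t11 * t22 - t12 * t21) * b = 0"
        using that by algebra+
      then show ?thesis using regular by simp
    qed
    have "y = 0" if y: "y \<in> ?S" for y
    proof -
      obtain a b where "y = ?s a b" "t11 * a + t12 * b = 0" "t21 * a + t22 * b = 0"
        using y unfolding space by blast
      then show ?thesis using ker[of a b] sl_seq_eq_0_iff[of f q w N x a b, OF f0] by simp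
    qed
    moreover have "0 \<in> ?S"
    proof -
      have "?s 0 0 \<in> ?S" unfolding space by (rule CollectI, intro exI[of _ 0]) simp
      then show ?thesis using f0 sl_seq_eq_0_iff[of f q w N x 0 0] by simp
    qed
    ultimately have "?S = {0}" by blast
    then show ?thesis
      using regular seq_vs.dim_span[of "{}"] seq_vs.dim_eq_card_independent[OF seq_vs.independent_empty] unfolding sl_mult_def sl_is_eig_def by simp
  next
    case line
    obtain a b where ab: "(a, b) \<noteq> (0, 0)"
      "\<And>c d. t11 * c + t12 * d = 0 \<and> t21 * c + t22 * d = 0 \<longleftrightarrow> (\<exists>k. c = k * a \<and> d = k * b)"
      using kernel_2x2_line[OF line] by blast
    have nz: "?s a b \<noteq> 0" using ab f0 by (simp add: sl_seq_eq_0_iff)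
    have S: "?S = seq_vs.span {?s a b}"
    proof (intro equalityI subsetI)
      fix y assume "y \<in> ?S"
      then obtain k where "y = ?s (k * a) (k * b)" unfolding space ab(2) by auto
      then show "y \<in> seq_vs.span {?s a b}" unfolding seq_vs.span_singleton sl_seq_scale by blast
    next
      fix y assume "y \<in> seq_vs.span {?s a b}"
      then obtain k where "y = ?s (k * a) (k * b)"
        unfolding seq_vs.span_singleton sl_seq_scale by auto
      then show "y \<in> ?S" unfolding space ab(2) by blast
    qed
    then have "seq_vs.dim ?S = 1"
      using nz by (simp add: seq_vs.dim_eq_card_independent)
    moreover have "?s a b \<in> ?S" unfolding S by (simp add: seq_vs.span_base)
    ultimately show ?thesis
      using line nz unfolding sl_mult_def sl_is_eig_def by auto
  next
    case plane
    have lin: "?s a b = seq_scale a (?s 1 0) + seq_scale b (?s 0 1)" for a b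
      by (auto simp: sl_seq_def seq_scale_def fun_eq_iff)
    have "?S = range (\<lambda>(a, b). ?s a b)" unfolding space using plane by auto
    also have "\<dots> = seq_vs.span {?s 1 0, ?s 0 1}"
    proof (intro equalityI subsetI)
      fix y assume "y \<in> range (\<lambda>(a, b). ?s a b)"
      then obtain a b where y: "y = ?s a b" by auto
      show "y \<in> seq_vs.span {?s 1 0, ?s 0 1}"
        unfolding y lin[of a b]
        by (rule seq_vs.span_add[OF seq_vs.span_scale[OF seq_vs.span_base] seq_vs.span_scale[OF seq_vs.span_base]]) auto
    next
      fix y assume "y \<in> seq_vs.span {?s 1 0, ?s 0 1}"
      then obtain k l where "y - seq_scale k (?s 1 0) = seq_scale l (?s 0 1)"
        unfolding seq_vs.span_insert[of _ "{?s 0 1}"] seq_vs.span_singleton by auto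
      then have "y = ?s k l" unfolding lin[of k l] by (simp add: algebra_simps)
      then show "y \<in> range (\<lambda>(a, b). ?s a b)" by auto
    qed
    finally have S: "?S = seq_vs.span {?s 1 0, ?s 0 1}" .
    have nz: "?s 0 1 \<noteq> 0" "?s 1 0 \<noteq> 0" using f0 by (simp_all add: sl_seq_eq_0_iff)
    have notin: "?s 1 0 \<notin> seq_vs.span {?s 0 1}"
    proof
      assume "?s 1 0 \<in> seq_vs.span {?s 0 1}"
      then obtain k where "?s 1 0 = seq_scale k (?s 0 1)"
        unfolding seq_vs.span_singleton by auto
      then have "?s 1 0 0 = seq_scale k (?s 0 1) 0" by simp
      then show False by (simp add: sl_seq_def seq_scale_def)
    qed
    then have "seq_vs.independent {?s 1 0, ?s 0 1}"
      using nz seq_vs.independent_insertI[of "?s 1 0" "{?s 0 1}"] by simp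
    moreover have "?s 1 0 \<noteq> ?s 0 1" using notin seq_vs.span_base by fastforce
    ultimately have "seq_vs.dim ?S = 2"
      unfolding S using seq_vs.dim_span_eq_card_independent[of "{?s 1 0, ?s 0 1}"] by simp
    moreover have "?s 1 0 \<in> ?S" unfolding S by (simp add: seq_vs.span_base)
    ultimately show ?thesis
      using plane nz unfolding sl_mult_def sl_is_eig_def by auto
  qed
  then show ?mult ?eig by blast+
qed

section \<open>The discriminant\<close>

locale sl_coupled =
  fixes N :: nat and f q w :: "nat \<Rightarrow> real" and M :: "real^2^2"
  assumes N2: "N \<ge> 2"
    and f_nz: "\<And>n. n \<le> N \<Longrightarrow> f n \<noteq> 0"
    and w_pos: "\<And>n. n \<in> {1..N} \<Longrightarrow> w n > 0"
    and det_M: "det M = 1"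
begin

lemma f01: "f 0 \<noteq> 0" "f 1 \<noteq> 0"
  using f_nz N2 by auto

lemma det_entries: "M$1$1 * M$2$2 - M$1$2 * M$2$1 = 1"
  using det_M by (simp add: det_2)

abbreviation "u1 x \<equiv> poly (slU f q w 1 0 N) x"
abbreviation "u2 x \<equiv> poly (slU f q w 0 1 N) x"
abbreviation "v1 x \<equiv> poly (slV f q w 1 0 N) x"
abbreviation "v2 x \<equiv> poly (slV f q w 0 1 N) x"

lemma wronskian: "u1 x * v2 x - u2 x * v1 x = 1"
  using arg_cong[OF slUV_wronskian[of f q w 1 0 N 0 1], of "\<lambda>p. poly p x"] by simp

definition discr :: "real poly" where
  "discr = smult (M$2$2) (slU f q w 1 0 N) - smult (M$1$2) (slV f q w 1 0 N)
         - smult (M$2$1) (slU f q w 0 1 N) + smult (M$1$1) (slV f q w 0 1 N)"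

text \<open>The entries of \<open>M\<inverse> \<Phi>\<close>, where \<open>\<Phi>\<close> is the transfer matrix from index 0 to index \<open>N\<close>;
  \<open>discr\<close> is its trace.\<close>

definition "a11 x = M$2$2 * u1 x - M$1$2 * v1 x"
definition "a12 x = M$2$2 * u2 x - M$1$2 * v2 x"
definition "a21 x = M$1$1 * v1 x - M$2$1 * u1 x"
definition "a22 x = M$1$1 * v2 x - M$2$1 * u2 x"

lemma poly_discr: "poly discr x = a11 x + a22 x"
  by (simp add: discr_def a11_def a22_def)

lemma a_det: "a11 x * a22 x - a12 x * a21 x = 1"
proof -
  have "a11 x * a22 x - a12 x * a21 x =
      (M$1$1 * M$2$2 - M$1$2 * M$2$1) * (u1 x * v2 x - u2 x * v1 x)"
    unfolding a11_def a12_def a21_def a22_def by algebra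
  then show ?thesis by (simp add: wronskian det_entries)
qed

text \<open>These are the entries of \<open>\<Phi> = M (M\<inverse> \<Phi>)\<close>; they recover
  \<Phi> once \<open>M\<inverse> \<Phi>\<close> is known to be scalar.\<close>

lemma M_mult_a:
  "u1 x = M$1$1 * a11 x + M$1$2 * a21 x" "u2 x = M$1$1 * a12 x + M$1$2 * a22 x"
  "v1 x = M$2$1 * a11 x + M$2$2 * a21 x" "v2 x = M$2$1 * a12 x + M$2$2 * a22 x"
  unfolding a11_def a12_def a21_def a22_def using det_entries by algebra+

section \<open>The derivative of the discriminant\<close>

abbreviation "r1 x k \<equiv> poly (slU f q w 1 0 k) x"
abbreviation "r2 x k \<equiv> poly (slU f q w 0 1 k) x"
text \<open>\<open>p11\<close>, \<open>p12\<close>, \<open>p22\<close> form the Gram matrix of the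
  two fundamental solutions for the inner product with weight \<open>w\<close>.\<close>

definition "p11 x = (\<Sum>k=1..N. w k * (r1 x k * r1 x k))"
definition "p12 x = (\<Sum>k=1..N. w k * (r1 x k * r2 x k))"
definition "p22 x = (\<Sum>k=1..N. w k * (r2 x k * r2 x k))"

text \<open>The Lagrange identities for the four pairs of fundamental solutions express the
  derivative of \<Phi> through \<Phi> and the Gram entries; what remains is a trace.\<close>

lemma discr_deriv:
  "poly (pderiv discr) x = - a12 x * p11 x + (a11 x - a22 x) * p12 x + a21 x * p22 x"
proof -
  define du1 where "du1 = poly (pderiv (slU f q w 1 0 N)) x"
  define du2 where "du2 = poly (pderiv (slU f q w 0 1 N)) x"
  define dv1 where "dv1 = poly (pderiv (slV f q w 1 0 N)) x"
  define dv2 where "dv2 = poly (pderiv (slV f q w 0 1 N)) x"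
  note L = arg_cong[OF slUV_lagrange[of f q w _ _ N], of "\<lambda>p. poly p x"]
  have e: "du1 * v1 x - u1 x * dv1 = p11 x" "du1 * v2 x - u2 x * dv1 = p12 x"
      "du2 * v1 x - u1 x * dv2 = p12 x" "du2 * v2 x - u2 x * dv2 = p22 x"
    using L[of 1 0 1 0] L[of 1 0 0 1] L[of 0 1 1 0] L[of 0 1 0 1]
    unfolding du1_def du2_def dv1_def dv2_def p11_def p12_def p22_def
    by (simp_all add: poly_sum mult.commute)
  \<comment> \<open>Cramer's rule for the linear system \<open>e\<close>, whose determinant is the
    Wronskian 1.\<close>
  have d1: "du1 = u1 x * p12 x - u2 x * p11 x" "dv1 = v1 x * p12 x - v2 x * p11 x"
    unfolding e(1,2)[symmetric] using wronskian[of x] by algebra+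
  have d2: "du2 = u1 x * p22 x - u2 x * p12 x" "dv2 = v1 x * p22 x - v2 x * p12 x"
    unfolding e(3,4)[symmetric] using wronskian[of x] by algebra+
  have "poly (pderiv discr) x = M$2$2 * du1 - M$1$2 * dv1 - M$2$1 * du2 + M$1$1 * dv2"
    unfolding discr_def du1_def du2_def dv1_def dv2_def
    by (simp add: pderiv_add pderiv_diff pderiv_smult)
  also have "\<dots> = - a12 x * p11 x + (a11 x - a22 x) * p12 x + a21 x * p22 x"
    unfolding d1 d2 a11_def a12_def a21_def a22_def by algebra
  finally show ?thesis .
qed

lemma p22_pos: "p22 x > 0"
proof -
  have "r2 x 1 \<noteq> 0" using f01 by (simp add: slU_Suc)
  then show ?thesis
    unfolding p22_def power2_eq_square[symmetric]
    using w_pos N2 by (intro sum_weighted_squares_pos[of _ _ 1]) auto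
qed

text \<open>On \<open>|discr| \<le> 2\<close> the quadratic form in \<open>discr_deriv\<close> is semidefinite, so its sum over the
  linearly independent values at the indices 1 and 2 can vanish only if the form itself does.\<close>

lemma discr_deriv_eq_0:
  assumes D: "\<bar>poly discr x\<bar> \<le> 2" and D': "poly (pderiv discr) x = 0"
  shows "a12 x = 0" "a21 x = 0" "a11 x = a22 x"
proof -
  let ?D = "poly discr x"
  have D2: "?D\<^sup>2 \<le> 4" using power_mono[OF D, of 2] by simp
  have disc: "(a11 x - a22 x)\<^sup>2 + 4 * a12 x * a21 x = ?D\<^sup>2 - 4"
    unfolding poly_discr using a_det[of x] by algebra
  show a12: "a12 x = 0"
  proof (rule ccontr)
    assume nz: "a12 x \<noteq> 0"
    \<comment> \<open>Completing the square: multiplied by \<open>- 4 * a12 x\<close>, the quadratic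
      form becomes the square of this combination up to a multiple of its discriminant, and the
      combination is itself a solution.\<close>
    define s where "s = (\<lambda>k. poly (slU f q w (2 * a12 x) (- (a11 x - a22 x)) k) x)"
    have s: "s k = 2 * a12 x * r1 x k - (a11 x - a22 x) * r2 x k" for k
      unfolding s_def using slUV_linear[of f q w "2 * a12 x" "- (a11 x - a22 x)" k] by (simp add: algebra_simps)
    have "(\<Sum>k=1..N. w k * (s k)\<^sup>2) =
        4 * (a12 x)\<^sup>2 * p11 x - 4 * a12 x * (a11 x - a22 x) * p12 x + (a11 x - a22 x)\<^sup>2 * p22 x"
      unfolding s p11_def p12_def p22_def sum_distrib_left
      by (simp add: power2_eq_square algebra_simps sum.distrib sum_subtractf)
    also have "\<dots> = - 4 * a12 x * poly (pderiv discr) x + (?D\<^sup>2 - 4) * p22 x"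
      unfolding discr_deriv disc[symmetric] by algebra
    also have "\<dots> \<le> 0" using D' D2 p22_pos[of x] by (simp add: mult_nonpos_nonneg)
    finally have le: "(\<Sum>k=1..N. w k * (s k)\<^sup>2) \<le> 0" .
    have "\<exists>k\<in>{1..N}. s k \<noteq> 0" unfolding s_def using f01 nz N2 by (intro slU_nontrivial) auto
    then obtain k where "k \<in> {1..N}" "s k \<noteq> 0" by blast
    then have "(\<Sum>k=1..N. w k * (s k)\<^sup>2) > 0"
      using w_pos by (intro sum_weighted_squares_pos) auto
    then show False using le by simp
  qed
  \<comment> \<open>With \<open>a12 x = 0\<close> the identity \<open>disc\<close> says that a
    square equals a nonpositive number.\<close>
  then show eq: "a11 x = a22 x" using disc D2
    by (metis add.right_neutral diff_le_0_iff_le mult_zero_left mult_zero_right power2_less_eq_zero_iff right_minus_eq)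
  show "a21 x = 0" using D' p22_pos[of x] unfolding discr_deriv a12 eq by simp
qed

text \<open>The data \<open>(M$2$2, - M$2$1)\<close> span the kernel of the first row of
  \<open>bc_V M\<close>; the second row asks for \<open>f N\<close> times the last difference to
  vanish. Zeros of \<open>vpoly\<close> are therefore the eigenvalues of the separated
  condition.\<close>

definition vpoly :: "real poly" where "vpoly = slV f q w (M$2$2) (- (M$2$1)) N"

lemma poly_vpoly: "poly vpoly x = M$2$2 * v1 x - M$2$1 * v2 x"
  unfolding vpoly_def using slUV_linear[of f q w "M$2$2" "- (M$2$1)" N] by simp

lemma row2_nz: "(M$2$2, - (M$2$1)) \<noteq> (0, 0)"
  using det_entries by auto

text \<open>At a zero of \<open>vpoly\<close> the vector \<open>(M$2$2, - M$2$1)\<close> is an eigenvector of \<open>M\<inverse> \<Phi>\<close>,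
  with eigenvalue the value \<open>s\<close> of the solution at \<open>N\<close>, so that \<open>discr\<close> equals \<open>s + 1 / s\<close> there.\<close>

lemma vpoly_root:
  assumes g: "poly vpoly x = 0"
  shows "\<bar>poly discr x\<bar> \<ge> 2" "poly discr x * poly (pderiv vpoly) x < 0"
proof -
  define s where "s = poly (slU f q w (M$2$2) (- (M$2$1)) N) x"
  have s: "s = M$2$2 * u1 x - M$2$1 * u2 x"
    unfolding s_def using slUV_linear[of f q w "M$2$2" "- (M$2$1)" N] by simp
  have *: "poly discr x * s = s\<^sup>2 + 1"
    using g wronskian[of x] det_entries unfolding poly_vpoly poly_discr a11_def a22_def s by algebra
  then have nz: "s \<noteq> 0" by auto
  have "4 * s\<^sup>2 \<le> (s\<^sup>2 + 1)\<^sup>2" using zero_le_power2[of "s\<^sup>2 - 1"] by (simp add: power2_eq_square algebra_simps)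
  also have "\<dots> = (poly discr x)\<^sup>2 * s\<^sup>2" unfolding *[symmetric] by (simp add: power_mult_distrib)
  finally have "2\<^sup>2 \<le> (poly discr x)\<^sup>2" using nz by simp
  then show "\<bar>poly discr x\<bar> \<ge> 2" using abs_le_square_iff[of 2 "poly discr x"] by simp
  obtain k where "k \<in> {1..N}" "poly (slU f q w (M$2$2) (- (M$2$1)) k) x \<noteq> 0"
    using slU_nontrivial[OF f01 row2_nz N2] by blast
  then have "0 < (\<Sum>k=1..N. w k * (poly (slU f q w (M$2$2) (- (M$2$1)) k) x)\<^sup>2)"
    using w_pos by (intro sum_weighted_squares_pos) auto
  \<comment> \<open>The Lagrange identity of the solution with itself; the term containing the value
    of \<open>vpoly\<close> drops out at the zero.\<close>
  also have "\<dots> = - s * poly (pderiv vpoly) x"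
    using arg_cong[OF slUV_lagrange[of f q w "M$2$2" "- (M$2$1)" N "M$2$2" "- (M$2$1)"], of "\<lambda>p. poly p x"] g
    unfolding vpoly_def s_def by (simp add: poly_sum power2_eq_square)
  finally have "s * poly (pderiv vpoly) x < 0" by simp
  moreover have "poly discr x * s > 0" unfolding * by (simp add: add_nonneg_pos)
  ultimately show "poly discr x * poly (pderiv vpoly) x < 0"
    by (auto simp: mult_less_0_iff zero_less_mult_iff)
qed

text \<open>With \<open>z = exp (\<i> * \<gamma>)\<close> the condition reads
  \<open>(z M - \<Phi>) (a, b) = 0\<close>, and the determinant of this matrix is
  \<open>z * (2 * cos \<gamma> - discr)\<close>. The matrix itself vanishes exactly when the
  derivative of \<open>discr\<close> also does.\<close>

lemma coupled_mult:
  fixes \<gamma> x :: real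
  defines "bc \<equiv> bc_coupled (\<chi> i j. exp (\<i> * complex_of_real \<gamma>) * cmat M $ i $ j)"
  shows "sl_mult f q w N bc (of_real x) =
      (if poly discr x \<noteq> 2 * cos \<gamma> then 0 else if poly (pderiv discr) x = 0 then 2 else 1)"
    and "sl_is_eig f q w N bc (of_real x) \<longleftrightarrow> poly discr x = 2 * cos \<gamma>"
proof -
  define z where "z = exp (\<i> * complex_of_real \<gamma>)"
  define t11 where "t11 = z * of_real (M$1$1) - of_real (u1 x)"
  define t12 where "t12 = z * of_real (M$1$2) - of_real (u2 x)"
  define t21 where "t21 = z * of_real (M$2$1) - of_real (v1 x)"
  define t22 where "t22 = z * of_real (M$2$2) - of_real (v2 x)"
  note t_defs = t11_def t12_def t21_def t22_def
  have bc: "fst bc *v vector [a, b] + snd bc *v vector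
         [a * of_real (u1 x) + b * of_real (u2 x), a * of_real (v1 x) + b * of_real (v2 x)] = 0 \<longleftrightarrow>
         t11 * a + t12 * b = 0 \<and> t21 * a + t22 * b = 0" for a b
    unfolding bc_def bc_coupled_def z_def[symmetric] t_defs
    by (simp add: vec_eq_iff forall_2 matrix_vector_mult_def sum_2 cmat_def mat_def algebra_simps)
  have zc: "z = of_real (cos \<gamma>) + \<i> * of_real (sin \<gamma>)"
    unfolding z_def by (simp add: cis_conv_exp[symmetric] complex_eq_iff)
  have zz: "z\<^sup>2 + 1 = 2 * of_real (cos \<gamma>) * z"
  proof -
    have "complex_of_real ((cos \<gamma>)\<^sup>2 + (sin \<gamma>)\<^sup>2) = 1" by simp
    then have "of_real (cos \<gamma>) * of_real (cos \<gamma>) + of_real (sin \<gamma>) * of_real (sin \<gamma>) = (1::complex)"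
      by (simp only: of_real_add of_real_mult power2_eq_square)
    then show ?thesis unfolding zc using i_squared by algebra
  qed
  have z0: "z \<noteq> 0" by (simp add: z_def)
  have det: "t11 * t22 - t12 * t21 = z * of_real (2 * cos \<gamma> - poly discr x)"
  proof -
    have "t11 * t22 - t12 * t21 = z\<^sup>2 * of_real (M$1$1 * M$2$2 - M$1$2 * M$2$1) - z * of_real (poly discr x)
        + of_real (u1 x * v2 x - u2 x * v1 x)"
      unfolding t_defs poly_discr a11_def a22_def by (simp add: algebra_simps power2_eq_square)
    then show ?thesis using zz by (simp add: det_entries wronskian algebra_simps)
  qed
  have plane: "(t11 = 0 \<and> t12 = 0 \<and> t21 = 0 \<and> t22 = 0) \<longleftrightarrow> poly (pderiv discr) x = 0"
    if D: "poly discr x = 2 * cos \<gamma>"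
  proof
    assume "t11 = 0 \<and> t12 = 0 \<and> t21 = 0 \<and> t22 = 0"
    then have t: "of_real (u1 x) = z * of_real (M$1$1)" "of_real (u2 x) = z * of_real (M$1$2)"
      "of_real (v1 x) = z * of_real (M$2$1)" "of_real (v2 x) = z * of_real (M$2$2)"
      unfolding t_defs by auto
    have dM: "complex_of_real (M$1$1) * of_real (M$2$2) - of_real (M$1$2) * of_real (M$2$1) = 1"
      using arg_cong[OF det_entries, of complex_of_real] by simp
    have "complex_of_real (a12 x) = 0" "complex_of_real (a21 x) = 0"
      "complex_of_real (a11 x) = z" "complex_of_real (a22 x) = z"
      unfolding a11_def a12_def a21_def a22_def of_real_diff of_real_mult t using dM by algebra+
    then have "a12 x = 0" "a21 x = 0" "a11 x = a22 x" by (simp, simp, metis of_real_eq_iff)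
    then show "poly (pderiv discr) x = 0" unfolding discr_deriv by simp
  next
    assume D': "poly (pderiv discr) x = 0"
    have "\<bar>poly discr x\<bar> \<le> 2" unfolding D using abs_cos_le_one[of \<gamma>] by linarith
    note a = discr_deriv_eq_0[OF this D']
    have a11: "a11 x = cos \<gamma>" using D a(3) by (simp add: poly_discr)
    \<comment> \<open>\<open>M\<inverse> \<Phi>\<close> is now scalar with determinant 1, so
      \<open>z\<close> is real and \<Phi> equals \<open>z M\<close>.\<close>
    then have "(cos \<gamma>)\<^sup>2 = 1" using a_det[of x] a by (simp add: power2_eq_square)
    then have "sin \<gamma> = 0" by (simp add: cos_squared_eq)
    then have "z = of_real (cos \<gamma>)" using zc by simp
    then show "t11 = 0 \<and> t12 = 0 \<and> t21 = 0 \<and> t22 = 0"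
      unfolding t_defs M_mult_a[of x] using a a11 by simp
  qed
  note mc = sl_mult_cases[where f = f and N = N and bc = bc and q = q and w = w and x = x
      and ?t11.0 = t11 and ?t12.0 = t12 and ?t21.0 = t21 and ?t22.0 = t22]
  have "of_real (2 * cos \<gamma> - poly discr x) = (0::complex) \<longleftrightarrow> poly discr x = 2 * cos \<gamma>"
    unfolding of_real_eq_0_iff by auto
  then have det0: "t11 * t22 - t12 * t21 = 0 \<longleftrightarrow> poly discr x = 2 * cos \<gamma>"
    unfolding det using z0 by (simp del: of_real_diff of_real_mult)
  show "sl_is_eig f q w N bc (of_real x) \<longleftrightarrow> poly discr x = 2 * cos \<gamma>"
    unfolding det0[symmetric] by (rule mc(2)) (intro f_nz bc, assumption?)+
  have "sl_mult f q w N bc (of_real x) =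
       (if t11 * t22 - t12 * t21 \<noteq> 0 then 0
        else if t11 = 0 \<and> t12 = 0 \<and> t21 = 0 \<and> t22 = 0 then 2 else 1)"
    by (rule mc(1)) (intro f_nz bc, assumption?)+
  then show "sl_mult f q w N bc (of_real x) =
      (if poly discr x \<noteq> 2 * cos \<gamma> then 0 else if poly (pderiv discr) x = 0 then 2 else 1)"
    using det0 plane by auto
qed

text \<open>Changing the sign of \<open>K\<close> only changes the sign of one equation. The first
  row of the resulting matrix is nonzero, which rules out multiplicity 2.\<close>

lemma bc_V_mult:
  assumes K: "K = M \<or> K = - M"
  shows "sl_mult f q w N (bc_V K) (of_real x) = (if poly vpoly x = 0 then 1 else 0)"
    and "sl_is_eig f q w N (bc_V K) (of_real x) \<longleftrightarrow> poly vpoly x = 0"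
proof -
  have bc: "fst (bc_V K) *v vector [a, b] + snd (bc_V K) *v vector
         [a * of_real (u1 x) + b * of_real (u2 x), a * of_real (v1 x) + b * of_real (v2 x)] = 0 \<longleftrightarrow>
         of_real (M$2$1) * a + of_real (M$2$2) * b = 0 \<and> of_real (v1 x) * a + of_real (v2 x) * b = 0" for a b
  proof -
    have "of_real (K$2$1) * a + of_real (K$2$2) * b = 0 \<longleftrightarrow>
        of_real (M$2$1) * a + of_real (M$2$2) * b = 0"
      using K neg_equal_0_iff_equal[of "of_real (M$2$1) * a + of_real (M$2$2) * b"] by auto
    then show ?thesis
      unfolding bc_V_def
      by (simp add: vec_eq_iff forall_2 matrix_vector_mult_def sum_2 cmat_def algebra_simps)
  qed
  note mc = sl_mult_cases[where f = f and N = N and bc = "bc_V K" and q = q and w = w and x = x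
      and ?t11.0 = "of_real (M$2$1)" and ?t12.0 = "of_real (M$2$2)"
      and ?t21.0 = "of_real (v1 x)" and ?t22.0 = "of_real (v2 x)"]
  have "of_real (M$2$1) * of_real (v2 x) - of_real (M$2$2) * of_real (v1 x) =
      (- of_real (poly vpoly x) :: complex)"
    by (simp add: poly_vpoly)
  then have det0: "of_real (M$2$1) * of_real (v2 x) - of_real (M$2$2) * of_real (v1 x) = (0::complex)
      \<longleftrightarrow> poly vpoly x = 0" by simp
  show "sl_is_eig f q w N (bc_V K) (of_real x) \<longleftrightarrow> poly vpoly x = 0"
    unfolding det0[symmetric] by (rule mc(2)) (intro f_nz bc, assumption?)+
  show "sl_mult f q w N (bc_V K) (of_real x) = (if poly vpoly x = 0 then 1 else 0)"
    using mc(1)[OF f_nz bc] det0 row2_nz by auto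
qed

end

section \<open>Bands and interlacing\<close>

lemma poly_ge_eventually_at_top:
  fixes p :: "real poly"
  assumes "degree p > 0" "lead_coeff p > 0"
  shows "\<exists>T. \<forall>x\<ge>T. poly p x \<ge> c"
proof -
  have "degree (p + [:- c:]) = degree p" using assms by (intro degree_add_eq_left) simp
  moreover from this have "lead_coeff (p + [:- c:]) = lead_coeff p"
    using assms by (simp add: coeff_eq_0)
  ultimately obtain T where "\<forall>x\<ge>T. poly (p + [:- c:]) x \<ge> lead_coeff p"
    using poly_pinfty_gt_lc[of "p + [:- c:]"] assms by auto
  then show ?thesis using assms(2) by (intro exI[of _ T]) force
qed

lemma poly_ge_eventually_at_bot:
  fixes p :: "real poly"
  assumes "degree p > 0" "(-1) ^ degree p * lead_coeff p > 0"
  shows "\<exists>T. \<forall>x\<le>T. poly p x \<ge> c"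
proof -
  let ?r = "pcompose p [:0, -1:]"
  have "degree ?r = degree p" by (simp add: degree_pcompose)
  moreover have "lead_coeff ?r = lead_coeff p * (-1) ^ degree p"
    by (subst lead_coeff_comp) simp_all
  ultimately obtain T where T: "\<forall>x\<ge>T. poly ?r x \<ge> c"
    using poly_ge_eventually_at_top[of ?r c] assms by (auto simp: mult.commute)
  have "poly p x \<ge> c" if "x \<le> - T" for x
    using T[rule_format, of "- x"] that by (simp add: poly_pcompose)
  then show ?thesis by blast
qed

text \<open>The maximum puts the additional node beyond both the last old node and the threshold
  \<open>T\<close>, where the sign of \<open>discr\<close> at infinity is already reached.\<close>

lemma strict_mono_extend_top:
  fixes \<nu> :: "nat \<Rightarrow> real"
  assumes \<nu>: "\<And>i j. i < j \<Longrightarrow> j < d \<Longrightarrow> \<nu> i < \<nu> j" and "i < j" "j < Suc d"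
  shows "(\<nu>(d := max T (\<nu> (d - 1) + 1))) i < (\<nu>(d := max T (\<nu> (d - 1) + 1))) j"
proof (cases "j = d")
  case True
  then have "i < d - 1 \<or> i = d - 1" using assms(2) by linarith
  then have "\<nu> i \<le> \<nu> (d - 1)" using \<nu>[of i "d - 1"] True assms(2) by auto
  then show ?thesis using True assms(2) by (auto simp: less_max_iff_disj)
next
  case False
  then show ?thesis using assms by auto
qed

section \<open>Degrees, leading coefficients and the zeros of \<open>vpoly\<close>\<close>

context sl_coupled
begin

text \<open>The common factor of all coefficients of degree \<open>N\<close> in the second
  components at index \<open>N\<close>; see \<open>coeff_slV\<close>.\<close>

definition "top_coeff = (\<Prod>k=1..N. - w k) * (\<Prod>i=0..N-1. 1 / f i)"

lemma top_coeff_sign: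
  assumes "(\<Prod>i=0..N-1. 1 / f i) > 0"
  shows "(-1) ^ N * top_coeff > 0"
proof -
  have "(\<Prod>k=1..N. - w k) = (-1) ^ N * (\<Prod>k=1..N. w k)"
    using prod.distrib[of "\<lambda>_. -1" w "{1..N}"] by simp
  then have "(-1) ^ N * top_coeff = (\<Prod>k=1..N. w k) * (\<Prod>i=0..N-1. 1 / f i)"
    by (simp add: top_coeff_def flip: power_mult_distrib)
  also have "\<dots> > 0" using w_pos by (intro mult_pos_pos[OF prod_pos assms]) auto
  finally show ?thesis .
qed

lemma coeff_slV: "coeff (slV f q w a b N) N = (f 0 * a + b) * top_coeff"
  using coeff_slV_top[of f q w a b "N - 1"] f01 N2 by (simp add: top_coeff_def)

lemma degree_slUV: "degree (slU f q w a b N) \<le> N - 1" "degree (slV f q w a b N) \<le> N"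
  using slUV_degree_le[of f q w a b "N - 1"] N2 by auto

lemma degree_discr_le: "degree discr \<le> N"
  unfolding discr_def using degree_slUV[of 1 0] degree_slUV[of 0 1] N2
  by (intro degree_add_le degree_diff_le order.trans[OF degree_smult_le]) auto

text \<open>Only the \<open>slV\<close> terms reach degree \<open>N\<close>, and the data
  \<open>(1, 0)\<close> and \<open>(0, 1)\<close> contribute the factors \<open>f 0\<close> and
  1.\<close>

lemma coeff_discr: "coeff discr N = (M$1$1 - f 0 * M$1$2) * top_coeff"
proof -
  have "coeff (slU f q w a b N) N = 0" for a b
    using degree_slUV(1)[of a b] N2 by (intro coeff_eq_0) auto
  then show ?thesis by (simp add: discr_def coeff_slV algebra_simps)
qed

abbreviation "vpoly_complex \<equiv> slV (cseq f) (cseq q) (cseq w) (of_real (M$2$2)) (of_real (- (M$2$1))) N"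

lemma vpoly_degree:
  assumes "top_coeff \<noteq> 0" "f 0 * M$2$2 - M$2$1 \<noteq> 0"
  shows "degree vpoly = N" "lead_coeff vpoly = (f 0 * M$2$2 - M$2$1) * top_coeff"
    "degree vpoly_complex = N"
proof -
  have c: "coeff vpoly N = (f 0 * M$2$2 - M$2$1) * top_coeff" by (simp add: vpoly_def coeff_slV)
  show d: "degree vpoly = N"
  proof (rule antisym)
    show "degree vpoly \<le> N" unfolding vpoly_def by (rule degree_slUV)
    show "N \<le> degree vpoly" using c assms by (intro le_degree) simp
  qed
  then show "lead_coeff vpoly = (f 0 * M$2$2 - M$2$1) * top_coeff" using c by simp
  have "coeff vpoly_complex N = of_real ((f 0 * M$2$2 - M$2$1) * top_coeff)"
    using coeff_slV_top[of "cseq f" "cseq q" "cseq w" "of_real (M$2$2)" "of_real (- (M$2$1))" "N - 1"] f01 N2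
    by (simp add: top_coeff_def)
  then have "coeff vpoly_complex N \<noteq> 0" using assms by (simp only: of_real_eq_0_iff mult_eq_0_iff) simp
  then show "degree vpoly_complex = N"
    using slUV_degree_le[of "cseq f" "cseq q" "cseq w" "of_real (M$2$2)" "of_real (- (M$2$1))" "N - 1"] N2
    by (intro antisym le_degree) auto
qed

text \<open>The solution defining \<open>vpoly\<close> now vanishes at index 1, which costs one
  degree. The leading coefficient is written as a multiple of \<open>top_coeff\<close> so that
  \<open>vpoly_zeros\<close> covers this case too.\<close>

lemma vpoly_degree_exceptional:
  assumes "top_coeff \<noteq> 0" and e: "f 0 * M$2$2 - M$2$1 = 0"
  shows "degree vpoly = N - 1" "lead_coeff vpoly = (M$2$2 * (f 0)\<^sup>2 / w 1) * top_coeff"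
    "degree vpoly_complex = N - 1"
proof -
  have Suc_N: "Suc (N - 2) = N - 1" "Suc (N - 1) = N" using N2 by auto
  have w1: "w 1 > 0" using w_pos N2 by simp
  define k where "k = (\<Prod>k=2..N. - w k) * (\<Prod>i=1..N-1. 1 / f i)"
  have "(\<Prod>k=1..N. - w k) = - w 1 * (\<Prod>k=2..N. - w k)"
    using prod.atLeast_Suc_atMost[of 1 N "\<lambda>k. - w k"] N2 by (simp add: numeral_2_eq_2)
  moreover have "(\<Prod>i=0..N-1. 1 / f i) = 1 / f 0 * (\<Prod>i=1..N-1. 1 / f i)"
    using prod.atLeast_Suc_atMost[of 0 "N - 1" "\<lambda>i. 1 / f i"] by simp
  ultimately have top: "top_coeff = - w 1 / f 0 * k" by (simp add: top_coeff_def k_def)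
  have m22: "M$2$2 \<noteq> 0" using e det_entries by auto
  have nz: "M$2$2 * (f 0)\<^sup>2 / w 1 * top_coeff \<noteq> 0" using m22 w1 f01 assms by simp
  have val: "- (M$2$1) * k = M$2$2 * (f 0)\<^sup>2 / w 1 * top_coeff"
  proof -
    have "M$2$1 = f 0 * M$2$2" using e by simp
    then show ?thesis using w1 f01 unfolding top by (simp add: power2_eq_square)
  qed
  have c: "coeff vpoly (N - 1) = M$2$2 * (f 0)\<^sup>2 / w 1 * top_coeff" "degree vpoly \<le> N - 1"
    using coeff_slV_top_shift[of f "M$2$2" "- (M$2$1)" q w "N - 2", unfolded Suc_N] e f01
    unfolding vpoly_def val[symmetric] k_def by simp_all
  show d: "degree vpoly = N - 1"
    using c nz by (intro antisym le_degree) auto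
  then show "lead_coeff vpoly = M$2$2 * (f 0)\<^sup>2 / w 1 * top_coeff" using c by simp
  have "of_real (f 0) * of_real (M$2$2) + of_real (- (M$2$1)) = complex_of_real (f 0 * M$2$2 - M$2$1)" by simp
  then have e': "of_real (f 0) * of_real (M$2$2) + of_real (- (M$2$1)) = (0::complex)" using e by simp
  have "coeff vpoly_complex (N - 1) = of_real (- (M$2$1) * k)" "degree vpoly_complex \<le> N - 1"
    using coeff_slV_top_shift[of "cseq f" "of_real (M$2$2)" "of_real (- (M$2$1))" "cseq q" "cseq w" "N - 2",
        OF e', unfolded Suc_N] f01
    unfolding k_def by simp_all
  then show "degree vpoly_complex = N - 1"
    using nz unfolding val by (intro antisym le_degree) auto
qed

text \<open>The sign of \<open>discr\<close> alternates along the zeros of \<open>vpoly\<close>, because that of its derivative does.\<close>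

lemma vpoly_zeros:
  assumes prod: "(-1) ^ N * top_coeff > 0"
    and deg: "degree vpoly = d" "degree vpoly_complex = d"
    and lc: "lead_coeff vpoly = c * top_coeff" "c \<noteq> 0" and d: "d \<le> N"
    and K: "K = M \<or> K = - M"
  obtains \<nu> where "\<And>i j. i < j \<Longrightarrow> j < d \<Longrightarrow> \<nu> i < \<nu> j"
    "\<And>j. j < d \<Longrightarrow> 0 < (-1) ^ j * ((-1) ^ (N - d) * c) * poly discr (\<nu> j)"
    "\<And>j. j < d \<Longrightarrow> \<bar>poly discr (\<nu> j)\<bar> \<ge> 2"
    "\<And>j. j < d \<Longrightarrow> sl_eig f q w N (bc_V K) j = \<nu> j"
proof -
  have nz: "vpoly \<noteq> 0" using lc prod by auto
  have card: "card {x. poly vpoly x = 0} = degree vpoly"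
    unfolding vpoly_def using slV_roots_card[OF N2 f01 w_pos row2_nz] deg unfolding vpoly_def by simp
  obtain \<nu> where \<nu>: "\<And>i j. i < j \<Longrightarrow> j < d \<Longrightarrow> \<nu> i < \<nu> j" "\<And>x. poly vpoly x = 0 \<longleftrightarrow> (\<exists>j<d. \<nu> j = x)"
    "\<And>j. j < d \<Longrightarrow> 0 < (-1) ^ (d - Suc j) * coeff vpoly d * poly (pderiv vpoly) (\<nu> j)"
    proof goal_cases
      case 1
      show ?case by (rule simple_roots_enum[OF nz card, unfolded deg]) (fact 1)+
    qed
  have root: "poly vpoly (\<nu> j) = 0" if "j < d" for j using \<nu>(2) that by blast
  show ?thesis
  proof (rule that[of \<nu>])
    fix j assume j: "j < d"
    show "\<bar>poly discr (\<nu> j)\<bar> \<ge> 2" using vpoly_root(1)[OF root[OF j]] .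
    define g' where "g' = poly (pderiv vpoly) (\<nu> j)"
    have Dg: "poly discr (\<nu> j) * g' < 0" unfolding g'_def using vpoly_root(2)[OF root[OF j]] .
    \<comment> \<open>The factor \<open>(-1) ^ N\<close> is split off because its product with
      \<open>top_coeff\<close> is positive; only the sign of \<open>c\<close>, the degree defect
      \<open>N - d\<close> and the position \<open>j\<close> are left.\<close>
    have "(-1::real) ^ (d - Suc j) = - ((-1) ^ N * (-1) ^ (N - d) * (-1) ^ j)"
      using j d by (auto simp: minus_one_power_iff)
    then have "0 < ((-1) ^ N * top_coeff) * - ((-1) ^ j * ((-1) ^ (N - d) * c) * g')"
      using \<nu>(3)[OF j] lc(1) unfolding g'_def deg by (simp add: algebra_simps)
    then have "0 < - ((-1) ^ j * ((-1) ^ (N - d) * c) * g')"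
      by (rule zero_less_mult_pos[OF _ prod])
    then have "(-1) ^ j * ((-1) ^ (N - d) * c) * g' < 0" by simp
    then show "0 < (-1) ^ j * ((-1) ^ (N - d) * c) * poly discr (\<nu> j)"
      using Dg by (auto simp: mult_less_0_iff zero_less_mult_iff)
  next
    fix j assume j: "j < d"
    show "sl_eig f q w N (bc_V K) j = \<nu> j"
      by (rule sl_eig_simple[where P = "\<lambda>x. poly vpoly x = 0" and n = d])
        (fact \<nu>(1) \<nu>(2) bc_V_mult[OF K] j)+
  qed (rule \<nu>(1))
qed

text \<open>Two bands meet only at a point where \<open>discr\<close> touches \<open>2\<close> or \<open>-2\<close> from inside;
  this is exactly where the eigenvalue is double.\<close>

lemma sl_eig_coupled:
  assumes degD: "degree discr = N"
    and t: "\<And>i j. i < j \<Longrightarrow> j \<le> N \<Longrightarrow> t i < t j"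
    and \<alpha>\<beta>: "\<And>j. j < N \<Longrightarrow> t j \<le> \<alpha> j" "\<And>j. j < N \<Longrightarrow> \<alpha> j < \<beta> j" "\<And>j. j < N \<Longrightarrow> \<beta> j \<le> t (Suc j)"
    and D\<alpha>: "\<And>j. j < N \<Longrightarrow> \<bar>poly discr (\<alpha> j)\<bar> = 2"
    and inside: "\<And>j x. j < N \<Longrightarrow> \<alpha> j < x \<Longrightarrow> x < \<beta> j \<Longrightarrow> \<bar>poly discr x\<bar> < 2"
    and \<mu>: "\<And>j. j < N \<Longrightarrow> \<alpha> j \<le> \<mu> j" "\<And>j. j < N \<Longrightarrow> \<mu> j \<le> \<beta> j"
      "\<And>j. j < N \<Longrightarrow> poly discr (\<mu> j) = 2 * cos \<gamma>"
    and j: "j < N"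
  shows "sl_eig f q w N (bc_coupled (\<chi> i j. exp (\<i> * complex_of_real \<gamma>) * cmat M $ i $ j)) j = \<mu> j"
proof -
  have t_le: "t i \<le> t j" if "i \<le> j" "j \<le> N" for i j
    using t[of i j] that by (cases "i = j") auto
  have sep: "\<beta> i \<le> \<alpha> j" if "i < j" "j < N" for i j
    using \<alpha>\<beta>(3)[of i] t_le[of "Suc i" j] \<alpha>\<beta>(1)[of j] that by linarith
  have mono: "\<mu> i \<le> \<mu> j" if "i \<le> j" "j < N" for i j
    using \<mu>(2)[of i] sep[of i j] \<mu>(1)[of j] that by (cases "i = j") auto
  \<comment> \<open>Distinct bands can share only an endpoint, and strict monotonicity of
    \<open>t\<close> allows that only for neighbours.\<close>
  have adj: "j = Suc i" and touch: "\<beta> i = \<mu> j" "\<alpha> j = \<mu> j" if "i < j" "j < N" "\<mu> i = \<mu> j" for i j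
  proof -
    show "\<beta> i = \<mu> j" "\<alpha> j = \<mu> j"
      using \<mu>(2)[of i] sep[of i j] \<mu>(1)[of j] that by linarith+
    then show "j = Suc i"
      using \<alpha>\<beta>(3)[of i] t[of "Suc i" j] \<alpha>\<beta>(1)[of j] that
      by (cases "j = Suc i") auto
  qed
  have double: "poly (pderiv discr) (\<mu> j) = 0" if ij: "i < j" "j < N" "\<mu> i = \<mu> j" for i j
  proof -
    define y where "y = \<mu> j"
    have y: "\<beta> i = y" "\<alpha> j = y" using touch[OF ij] by (auto simp: y_def)
    have Dy: "\<bar>poly discr y\<bar> = 2" using D\<alpha>[of j] ij y by simp
    \<comment> \<open>This radius stays within the two adjacent bands, so at their common endpoint
      \<open>discr\<close> has a local extremum.\<close>
    define \<delta> where "\<delta> = min (y - \<alpha> i) (\<beta> j - y)"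
    have \<delta>: "\<delta> > 0" unfolding \<delta>_def using \<alpha>\<beta>(2)[of i] \<alpha>\<beta>(2)[of j] y ij by auto
    have near: "\<bar>poly discr x\<bar> \<le> 2" if x: "\<bar>y - x\<bar> < \<delta>" for x
    proof -
      consider "x = y" | "\<alpha> i < x" "x < \<beta> i" | "\<alpha> j < x" "x < \<beta> j"
        using x y unfolding \<delta>_def by linarith
      then show ?thesis
        using inside[of i x] inside[of j x] Dy ij by cases auto
    qed
    show ?thesis
    proof (cases "poly discr y = 2")
      case True
      then have "\<forall>x. \<bar>y - x\<bar> < \<delta> \<longrightarrow> poly discr x \<le> poly discr y" using near by (auto dest: abs_le_D1)
      then show ?thesis using DERIV_local_max[OF poly_DERIV \<delta>] by (simp add: y_def)
    next
      case False
      then have "poly discr y = - 2" using Dy by linarith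
      then have "\<forall>x. \<bar>y - x\<bar> < \<delta> \<longrightarrow> poly discr y \<le> poly discr x"
        using near by (metis abs_le_D2 minus_le_iff)
      then show ?thesis using DERIV_local_min[OF poly_DERIV \<delta>] by (simp add: y_def)
    qed
  qed
  have card2: "card {i. i < N \<and> \<mu> i = x} \<le> 2" for x
  proof (cases "{i. i < N \<and> \<mu> i = x} = {}")
    case False
    define m where "m = Min {i. i < N \<and> \<mu> i = x}"
    have m: "m < N" "\<mu> m = x" using Min_in[OF _ False] by (auto simp: m_def)
    have "i \<in> {m, Suc m}" if i: "i < N" "\<mu> i = x" for i
    proof -
      have "m \<le> i" unfolding m_def using i by (intro Min_le) auto
      then show ?thesis using adj[of m i] i m by (cases "m = i") auto
    qed
    then have "{i. i < N \<and> \<mu> i = x} \<subseteq> {m, Suc m}" by blast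
    then have "card {i. i < N \<and> \<mu> i = x} \<le> card {m, Suc m}" by (intro card_mono) auto
    then show ?thesis by simp
  next
    case True
    then show ?thesis by (metis card.empty zero_le)
  qed
  define p where "p = discr + [:- (2 * cos \<gamma>):]"
  have degp: "degree p = N"
    using degree_add_eq_left[of "[:- (2 * cos \<gamma>):]" discr] degD N2 by (simp add: p_def)
  have p0: "p \<noteq> 0" using degp N2 by auto
  have dp: "pderiv p = pderiv discr" by (simp add: p_def pderiv_add pderiv_pCons)
  have dp0: "pderiv p \<noteq> 0" using degp N2 by (simp add: pderiv_eq_0_iff)
  have root_p: "poly p x = 0 \<longleftrightarrow> poly discr x = 2 * cos \<gamma>" for x by (simp add: p_def)
  have order1: "order x p \<ge> 1" if "poly discr x = 2 * cos \<gamma>" for x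
    using that p0 order_root[of p x] by (simp add: root_p Suc_le_eq)
  have ord: "order x p = Suc (order x (pderiv discr))" if "poly discr x = 2 * cos \<gamma>" for x
    using order_pderiv[OF p0, of x] that by (simp add: root_p dp)
  have order2: "order x p \<ge> 2 \<longleftrightarrow> poly (pderiv discr) x = 0" if "poly discr x = 2 * cos \<gamma>" for x
    using ord[OF that] order_root[of "pderiv discr" x] dp0 by (auto simp: dp)
  have order_card: "order x p = card {i. i < N \<and> \<mu> i = x}" for x
  proof (rule order_eq_card_roots)
    fix j assume j: "j < N"
    show "card {i. i < N \<and> \<mu> i = \<mu> j} \<le> order (\<mu> j) p"
    proof (cases "\<exists>i<N. i \<noteq> j \<and> \<mu> i = \<mu> j")
      case True
      then obtain i where i: "i < N" "i \<noteq> j" "\<mu> i = \<mu> j" by blast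
      have "poly (pderiv discr) (\<mu> j) = 0"
        using double[of i j] double[of j i] i j by (cases "i < j") auto
      then have "order (\<mu> j) p \<ge> 2" using order2 \<mu>(3)[OF j] by blast
      then show ?thesis using card2[of "\<mu> j"] by linarith
    next
      case False
      then have "{i. i < N \<and> \<mu> i = \<mu> j} = {j}" using j by auto
      then show ?thesis using order1[OF \<mu>(3)[OF j]] by simp
    qed
  qed (use p0 degp in auto)
  show ?thesis
  proof (rule sl_eig_eqI[OF mono])
    fix x
    have eig_iff: "poly discr x = 2 * cos \<gamma> \<longleftrightarrow> (\<exists>j<N. \<mu> j = x)"
    proof
      assume "poly discr x = 2 * cos \<gamma>"
      then have "card {i. i < N \<and> \<mu> i = x} \<noteq> 0" using order1[of x] order_card[of x] by linarith
      then have "{i. i < N \<and> \<mu> i = x} \<noteq> {}" by (metis card.empty)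
      then show "\<exists>j<N. \<mu> j = x" by blast
    qed (use \<mu>(3) in auto)
    show "sl_is_eig f q w N (bc_coupled (\<chi> i j. exp (\<i> * complex_of_real \<gamma>) * cmat M $ i $ j)) (of_real x)
        \<longleftrightarrow> (\<exists>j<N. \<mu> j = x)"
      unfolding coupled_mult(2) by (rule eig_iff)
    show "sl_mult f q w N (bc_coupled (\<chi> i j. exp (\<i> * complex_of_real \<gamma>) * cmat M $ i $ j)) (of_real x)
        = card {j. j < N \<and> \<mu> j = x}"
    proof (cases "poly discr x = 2 * cos \<gamma>")
      case True
      then show ?thesis
        using order1[of x] order2[of x] card2[of x] unfolding coupled_mult(1) order_card by auto
    next
      case False
      then have "{j. j < N \<and> \<mu> j = x} = {}" using eig_iff by blast
      then show ?thesis unfolding coupled_mult(1) using False by (metis card.empty)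
    qed
  qed (use j in auto)
qed

section \<open>Behaviour of the discriminant at infinity and its bands\<close>

lemma degree_discr:
  assumes "M$1$1 - f 0 * M$1$2 > 0" "(-1) ^ N * top_coeff > 0"
  shows "degree discr = N"
  using degree_discr_le coeff_discr assms by (intro antisym le_degree) auto

lemma discr_at_top:
  assumes "M$1$1 - f 0 * M$1$2 > 0" "(-1) ^ N * top_coeff > 0"
  shows "\<exists>T. \<forall>x\<ge>T. (-1) ^ N * poly discr x \<ge> 2"
proof -
  have "(-1) ^ N * lead_coeff discr > 0"
    using mult_pos_pos[OF assms] unfolding degree_discr[OF assms] coeff_discr by (simp add: mult_ac)
  then show ?thesis
    using poly_ge_eventually_at_top[of "smult ((-1) ^ N) discr" 2] degree_discr[OF assms] N2 by simp
qed

lemma discr_at_bot: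
  assumes "M$1$1 - f 0 * M$1$2 > 0" "(-1) ^ N * top_coeff > 0"
  shows "\<exists>T. \<forall>x\<le>T. poly discr x \<ge> 2"
proof -
  have "(-1) ^ N * lead_coeff discr > 0"
    using mult_pos_pos[OF assms] unfolding degree_discr[OF assms] coeff_discr by (simp add: mult_ac)
  then show ?thesis
    using poly_ge_eventually_at_bot[of discr 2] degree_discr[OF assms] N2 by simp
qed

text \<open>On band \<open>j\<close>, \<open>discr\<close> runs from \<open>2 * (-1) ^ j\<close> to
  \<open>- 2 * (-1) ^ j\<close>. The endpoint with value 2 belongs to \<open>M\<close> and the one
  with value -2 to \<open>- M\<close>, hence the dependence on parity.\<close>

definition in_bands :: "real \<Rightarrow> (nat \<Rightarrow> real) \<Rightarrow> (nat \<Rightarrow> real) \<Rightarrow> bool" where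
  "in_bands \<gamma> \<alpha> \<beta> \<longleftrightarrow> (\<forall>j<N.
     sl_eig f q w N (bc_coupled (cmat M)) j = (if even j then \<alpha> j else \<beta> j) \<and>
     sl_eig f q w N (bc_coupled (cmat (- M))) j = (if even j then \<beta> j else \<alpha> j) \<and>
     \<alpha> j < sl_eig f q w N (bc_coupled (\<chi> i j. exp (\<i> * complex_of_real \<gamma>) * cmat M $ i $ j)) j \<and>
     sl_eig f q w N (bc_coupled (\<chi> i j. exp (\<i> * complex_of_real \<gamma>) * cmat M $ i $ j)) j < \<beta> j)"

text \<open>\<open>sl_eig_coupled\<close> is used three times on the same bands: for the angles 0
  and \<open>pi\<close> with endpoints as eigenvalues, and for \<gamma> with interior
  points.\<close>

lemma coupled_bands:
  assumes lead: "M$1$1 - f 0 * M$1$2 > 0" and prod: "(-1) ^ N * top_coeff > 0"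
    and \<gamma>: "-pi < \<gamma>" "\<gamma> < pi" "\<gamma> \<noteq> 0"
    and t: "\<And>i j. i < j \<Longrightarrow> j \<le> N \<Longrightarrow> t i < t j"
    and s: "\<And>j. j \<le> N \<Longrightarrow> (-1) ^ j * poly discr (t j) \<ge> 2"
  obtains \<alpha> \<beta> where
    "\<And>j. j < N \<Longrightarrow> t j \<le> \<alpha> j" "\<And>j. j < N \<Longrightarrow> \<beta> j \<le> t (Suc j)" "in_bands \<gamma> \<alpha> \<beta>"
proof -
  note degD = degree_discr[OF lead prod]
  obtain \<alpha> \<beta> where ab: "\<And>j. j < N \<Longrightarrow> t j \<le> \<alpha> j" "\<And>j. j < N \<Longrightarrow> \<alpha> j < \<beta> j" "\<And>j. j < N \<Longrightarrow> \<beta> j \<le> t (Suc j)"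
    and D: "\<And>j. j < N \<Longrightarrow> poly discr (\<alpha> j) = 2 * (-1) ^ j" "\<And>j. j < N \<Longrightarrow> poly discr (\<beta> j) = - 2 * (-1) ^ j"
    and inside: "\<And>j x. j < N \<Longrightarrow> \<alpha> j < x \<Longrightarrow> x < \<beta> j \<Longrightarrow> \<bar>poly discr x\<bar> < 2"
    proof goal_cases
      case 1
      show ?case by (rule poly_bands[where N = N and t = t and D = discr]) (fact t s 1)+
    qed
  have D\<alpha>: "\<bar>poly discr (\<alpha> j)\<bar> = 2" if "j < N" for j
    using D(1)[OF that] by (simp add: abs_mult power_abs)
  have eig: "sl_eig f q w N (bc_coupled (\<chi> i j. exp (\<i> * complex_of_real \<phi>) * cmat M $ i $ j)) j = \<mu> j"
    if "\<And>j. j < N \<Longrightarrow> \<alpha> j \<le> \<mu> j" "\<And>j. j < N \<Longrightarrow> \<mu> j \<le> \<beta> j"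
      "\<And>j. j < N \<Longrightarrow> poly discr (\<mu> j) = 2 * cos \<phi>" "j < N" for \<mu> \<phi> j
    by (rule sl_eig_coupled[where t = t and \<alpha> = \<alpha> and \<beta> = \<beta>])
      (fact degD t ab D\<alpha> inside that)+
  have e0: "(\<chi> i j. exp (\<i> * complex_of_real 0) * cmat M $ i $ j) = cmat M"
    by (simp add: vec_eq_iff)
  have e\<pi>: "(\<chi> i j. exp (\<i> * complex_of_real pi) * cmat M $ i $ j) = cmat (- M)"
    by (simp add: vec_eq_iff cmat_def mult.commute[of \<i>])
  have cos: "\<bar>2 * cos \<gamma>\<bar> < 2"
  proof -
    have "cos pi < cos \<bar>\<gamma>\<bar>" "cos \<bar>\<gamma>\<bar> < cos 0" using \<gamma> by (intro cos_monotone_0_pi; simp)+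
    then show ?thesis by (simp add: abs_less_iff)
  qed
  have "\<exists>x. j < N \<longrightarrow> \<alpha> j < x \<and> x < \<beta> j \<and> poly discr x = 2 * cos \<gamma>" for j
  proof (cases "j < N")
    case True
    define p where "p = discr - [:2 * cos \<gamma>:]"
    \<comment> \<open>The endpoint values are \<open>2 - 2 * cos \<gamma>\<close> and
      \<open>- 2 - 2 * cos \<gamma>\<close> in some order, so the product does not depend on the
      parity of \<open>j\<close>.\<close>
    have "poly p (\<alpha> j) * poly p (\<beta> j) = (2 * cos \<gamma>)\<^sup>2 - 4"
      using D[OF True] by (cases "even j") (simp_all add: p_def power2_eq_square algebra_simps)
    also have "\<dots> < 0" using power_strict_mono[OF cos, of 2] by simp
    finally obtain x where "\<alpha> j < x" "x < \<beta> j" "poly p x = 0"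
      using poly_IVT[OF ab(2)[OF True], of p] by blast
    then show ?thesis by (auto simp: p_def)
  qed auto
  then obtain \<mu> where \<mu>: "\<And>j. j < N \<Longrightarrow> \<alpha> j < \<mu> j" "\<And>j. j < N \<Longrightarrow> \<mu> j < \<beta> j"
    "\<And>j. j < N \<Longrightarrow> poly discr (\<mu> j) = 2 * cos \<gamma>" by metis
  show ?thesis
  proof (rule that[OF ab(1,3)])
    have "sl_eig f q w N (bc_coupled (cmat M)) j = (if even j then \<alpha> j else \<beta> j)" if j: "j < N" for j
    proof (subst e0[symmetric], rule eig[of "\<lambda>j. if even j then \<alpha> j else \<beta> j"])
    qed (use D j ab(2) in \<open>auto simp: less_imp_le\<close>)
    moreover have "sl_eig f q w N (bc_coupled (cmat (- M))) j = (if even j then \<beta> j else \<alpha> j)" if j: "j < N" for j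
    proof (subst e\<pi>[symmetric], rule eig[of "\<lambda>j. if even j then \<beta> j else \<alpha> j"])
    qed (use D j ab(2) in \<open>auto simp: less_imp_le\<close>)
    moreover have "sl_eig f q w N (bc_coupled (\<chi> i j. exp (\<i> * complex_of_real \<gamma>) * cmat M $ i $ j)) j = \<mu> j"
      if j: "j < N" for j
      by (intro eig[of \<mu>]) (use \<mu> j in \<open>auto simp: less_imp_le\<close>)
    ultimately show "in_bands \<gamma> \<alpha> \<beta>" using \<mu> by (simp add: in_bands_def)
  qed auto
qed

text \<open>All \<open>N\<close> zeros of \<open>vpoly\<close> carry the signs required of the nodes
  \<open>t 0\<close>, ..., \<open>t (N - 1)\<close>. The missing last node is placed far to the
  right, so zero \<open>j\<close> lies to the left of band \<open>j\<close>.\<close>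

lemma interlacing_pos:
  assumes lead: "M$1$1 - f 0 * M$1$2 > 0" and prod: "(-1) ^ N * top_coeff > 0"
    and \<gamma>: "-pi < \<gamma>" "\<gamma> < pi" "\<gamma> \<noteq> 0"
    and e: "f 0 * M$2$2 - M$2$1 > 0" and K: "K = M \<or> K = - M"
  obtains \<alpha> \<beta> where "in_bands \<gamma> \<alpha> \<beta>"
    "\<And>j. j < N \<Longrightarrow> sl_eig f q w N (bc_V K) j \<le> \<alpha> j"
    "\<And>j. j + 1 < N \<Longrightarrow> \<beta> j \<le> sl_eig f q w N (bc_V K) (j + 1)"
proof -
  have "top_coeff \<noteq> 0" using prod by auto
  note deg = vpoly_degree[OF this, OF less_imp_neq[OF e, symmetric]]
  obtain \<nu> where \<nu>: "\<And>i j. i < j \<Longrightarrow> j < N \<Longrightarrow> \<nu> i < \<nu> j"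
    "\<And>j. j < N \<Longrightarrow> 0 < (-1) ^ j * ((-1) ^ (N - N) * (f 0 * M$2$2 - M$2$1)) * poly discr (\<nu> j)"
    "\<And>j. j < N \<Longrightarrow> \<bar>poly discr (\<nu> j)\<bar> \<ge> 2"
    "\<And>j. j < N \<Longrightarrow> sl_eig f q w N (bc_V K) j = \<nu> j"
    proof goal_cases
      case 1
      show ?case by (rule vpoly_zeros[OF prod deg(1,3,2) less_imp_neq[OF e, symmetric] order_refl K]) (fact 1)+
    qed
  have sgn: "(-1) ^ j * poly discr (\<nu> j) \<ge> 2" if "j < N" for j
    using \<nu>(2,3)[OF that] e by (cases "even j") (auto simp: zero_less_mult_iff mult_less_0_iff)
  obtain T where T: "\<And>x. x \<ge> T \<Longrightarrow> (-1) ^ N * poly discr x \<ge> 2"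
    using discr_at_top[OF lead prod] by blast
  define t where "t = \<nu>(N := max T (\<nu> (N - 1) + 1))"
  have t: "t i < t j" if "i < j" "j \<le> N" for i j
    unfolding t_def by (rule strict_mono_extend_top[OF \<nu>(1)]) (use that N2 in auto)
  have t_sgn: "(-1) ^ j * poly discr (t j) \<ge> 2" if "j \<le> N" for j
    using that sgn[of j] T[of "t N"] by (cases "j = N") (auto simp: t_def)
  obtain \<alpha> \<beta> where ab: "\<And>j. j < N \<Longrightarrow> t j \<le> \<alpha> j" "\<And>j. j < N \<Longrightarrow> \<beta> j \<le> t (Suc j)" "in_bands \<gamma> \<alpha> \<beta>"
    proof goal_cases
      case 1
      show ?case by (rule coupled_bands[where t = t and \<gamma> = \<gamma>]) (fact lead prod \<gamma> t t_sgn 1)+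
    qed
  show ?thesis
  proof (rule that[OF ab(3)])
    show "sl_eig f q w N (bc_V K) j \<le> \<alpha> j" if "j < N" for j
      using ab(1)[OF that] \<nu>(4)[OF that] that by (simp add: t_def)
    show "\<beta> j \<le> sl_eig f q w N (bc_V K) (j + 1)" if "j + 1 < N" for j
      using ab(2)[of j] \<nu>(4)[OF that] that by (simp add: t_def)
  qed
qed

text \<open>The signs are opposite to those in \<open>interlacing_pos\<close>, so
  \<open>\<nu> j\<close> serves as node \<open>j + 1\<close> and the missing node 0 is placed far to
  the left. Each separator then lies to the right of the band with its index.\<close>

lemma interlacing_of_separators:
  assumes lead: "M$1$1 - f 0 * M$1$2 > 0" and prod: "(-1) ^ N * top_coeff > 0"
    and \<gamma>: "-pi < \<gamma>" "\<gamma> < pi" "\<gamma> \<noteq> 0"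
    and \<nu>: "\<And>i j. i < j \<Longrightarrow> j < N \<Longrightarrow> \<nu> i < \<nu> j" "\<And>j. j < N \<Longrightarrow> (-1) ^ j * poly discr (\<nu> j) \<le> - 2"
  obtains \<alpha> \<beta> where "in_bands \<gamma> \<alpha> \<beta>" "\<And>j. j < N \<Longrightarrow> \<beta> j \<le> \<nu> j" "\<And>j. j + 1 < N \<Longrightarrow> \<nu> j \<le> \<alpha> (j + 1)"
proof -
  obtain T where T: "\<And>x. x \<le> T \<Longrightarrow> poly discr x \<ge> 2"
    using discr_at_bot[OF lead prod] by blast
  define t where "t = (\<lambda>j. case j of 0 \<Rightarrow> min T (\<nu> 0 - 1) | Suc i \<Rightarrow> \<nu> i)"
  have le: "\<nu> 0 \<le> \<nu> j" if "j < N" for j using \<nu>(1)[of 0 j] that by (cases "j = 0") auto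
  have t: "t i < t j" if "i < j" "j \<le> N" for i j
    using that \<nu>(1)[of "i - 1" "j - 1"] le[of "j - 1"] by (auto simp: t_def split: nat.splits)
  have t_sgn: "(-1) ^ j * poly discr (t j) \<ge> 2" if "j \<le> N" for j
    using that \<nu>(2)[of "j - 1"] T[of "t 0"] by (cases j) (auto simp: t_def)
  obtain \<alpha> \<beta> where ab: "\<And>j. j < N \<Longrightarrow> t j \<le> \<alpha> j" "\<And>j. j < N \<Longrightarrow> \<beta> j \<le> t (Suc j)" "in_bands \<gamma> \<alpha> \<beta>"
    proof goal_cases
      case 1
      show ?case by (rule coupled_bands[where t = t and \<gamma> = \<gamma>]) (fact lead prod \<gamma> t t_sgn 1)+
    qed
  show ?thesis
    by (rule that[OF ab(3)]) (use ab(1)[of "Suc _"] ab(2) in \<open>auto simp: t_def\<close>)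
qed

lemma interlacing_neg:
  assumes lead: "M$1$1 - f 0 * M$1$2 > 0" and prod: "(-1) ^ N * top_coeff > 0"
    and \<gamma>: "-pi < \<gamma>" "\<gamma> < pi" "\<gamma> \<noteq> 0"
    and e: "f 0 * M$2$2 - M$2$1 < 0" and K: "K = M \<or> K = - M"
  obtains \<alpha> \<beta> where "in_bands \<gamma> \<alpha> \<beta>"
    "\<And>j. j < N \<Longrightarrow> \<beta> j \<le> sl_eig f q w N (bc_V K) j"
    "\<And>j. j + 1 < N \<Longrightarrow> sl_eig f q w N (bc_V K) j \<le> \<alpha> (j + 1)"
proof -
  have "top_coeff \<noteq> 0" using prod by auto
  note deg = vpoly_degree[OF this, OF less_imp_neq[OF e]]
  obtain \<nu> where \<nu>: "\<And>i j. i < j \<Longrightarrow> j < N \<Longrightarrow> \<nu> i < \<nu> j"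
    "\<And>j. j < N \<Longrightarrow> 0 < (-1) ^ j * ((-1) ^ (N - N) * (f 0 * M$2$2 - M$2$1)) * poly discr (\<nu> j)"
    "\<And>j. j < N \<Longrightarrow> \<bar>poly discr (\<nu> j)\<bar> \<ge> 2"
    "\<And>j. j < N \<Longrightarrow> sl_eig f q w N (bc_V K) j = \<nu> j"
    proof goal_cases
      case 1
      show ?case by (rule vpoly_zeros[OF prod deg(1,3,2) less_imp_neq[OF e] order_refl K]) (fact 1)+
    qed
  have sgn: "(-1) ^ j * poly discr (\<nu> j) \<le> - 2" if "j < N" for j
    using \<nu>(2,3)[OF that] e by (cases "even j") (auto simp: zero_less_mult_iff mult_less_0_iff)
  obtain \<alpha> \<beta> where ab: "in_bands \<gamma> \<alpha> \<beta>" "\<And>j. j < N \<Longrightarrow> \<beta> j \<le> \<nu> j" "\<And>j. j + 1 < N \<Longrightarrow> \<nu> j \<le> \<alpha> (j + 1)"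
    proof goal_cases
      case 1
      show ?case by (rule interlacing_of_separators[where \<nu> = \<nu> and \<gamma> = \<gamma>]) (fact lead prod \<gamma> \<nu>(1) sgn 1)+
    qed
  show ?thesis
    by (rule that[OF ab(1)]) (use ab(2,3) \<nu>(4) in auto)
qed

text \<open>Only \<open>N - 1\<close> zeros exist. The degree defect of one reverses their signs, so
  they act as separators; an auxiliary last one is added far to the right, and nothing is claimed
  about it.\<close>

lemma interlacing_exceptional:
  assumes lead: "M$1$1 - f 0 * M$1$2 > 0" and prod: "(-1) ^ N * top_coeff > 0"
    and \<gamma>: "-pi < \<gamma>" "\<gamma> < pi" "\<gamma> \<noteq> 0"
    and e: "f 0 * M$2$2 - M$2$1 = 0" and K: "K = M \<or> K = - M"
  obtains \<alpha> \<beta> where "in_bands \<gamma> \<alpha> \<beta>"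
    "\<And>j. j + 1 < N \<Longrightarrow> \<beta> j \<le> sl_eig f q w N (bc_V K) j"
    "\<And>j. j + 1 < N \<Longrightarrow> sl_eig f q w N (bc_V K) j \<le> \<alpha> (j + 1)"
proof -
  have "top_coeff \<noteq> 0" using prod by auto
  note deg = vpoly_degree_exceptional[OF this e]
  define c where "c = M$2$2 * (f 0)\<^sup>2 / w 1"
  \<comment> \<open>Substituting \<open>M$2$1 = f 0 * M$2$2\<close> into \<open>det M = 1\<close>;
    this fixes the sign of the leading factor \<open>c\<close>.\<close>
  have "M$2$2 * (M$1$1 - f 0 * M$1$2) = 1" using e det_entries by algebra
  then have "M$2$2 > 0" using lead by (metis zero_less_mult_pos2 zero_less_one)
  then have c: "c > 0" unfolding c_def using w_pos[of 1] f01 N2 by simp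
  obtain \<nu> where \<nu>: "\<And>i j. i < j \<Longrightarrow> j < N - 1 \<Longrightarrow> \<nu> i < \<nu> j"
    "\<And>j. j < N - 1 \<Longrightarrow> 0 < (-1) ^ j * ((-1) ^ (N - (N - 1)) * c) * poly discr (\<nu> j)"
    "\<And>j. j < N - 1 \<Longrightarrow> \<bar>poly discr (\<nu> j)\<bar> \<ge> 2"
    "\<And>j. j < N - 1 \<Longrightarrow> sl_eig f q w N (bc_V K) j = \<nu> j"
    proof goal_cases
      case 1
      show ?case by (rule vpoly_zeros[OF prod deg(1,3) deg(2)[folded c_def] less_imp_neq[OF c, symmetric] diff_le_self K]) (fact 1)+
    qed
  have sgn: "(-1) ^ j * poly discr (\<nu> j) \<le> - 2" if "j < N - 1" for j
    using \<nu>(2,3)[OF that] c N2 by (cases "even j") (auto simp: zero_less_mult_iff mult_less_0_iff)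
  obtain T where T: "\<And>x. x \<ge> T \<Longrightarrow> (-1) ^ N * poly discr x \<ge> 2"
    using discr_at_top[OF lead prod] by blast
  define \<nu>' where "\<nu>' = \<nu>(N - 1 := max T (\<nu> (N - 1 - 1) + 1))"
  have mono': "\<nu>' i < \<nu>' j" if "i < j" "j < N" for i j
    unfolding \<nu>'_def by (rule strict_mono_extend_top[OF \<nu>(1)]) (use that N2 in auto)
  have sgn': "(-1) ^ j * poly discr (\<nu>' j) \<le> - 2" if "j < N" for j
  proof (cases "j = N - 1")
    case True
    \<comment> \<open>The auxiliary separator has index \<open>N - 1\<close>, so the sign of
      \<open>discr\<close> at infinity, stated with \<open>(-1) ^ N\<close>, is reversed.\<close>
    have "(-1::real) ^ N = - ((-1) ^ (N - 1))" using N2 by (cases N) auto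
    then show ?thesis using T[of "\<nu>' (N - 1)"] True by (simp add: \<nu>'_def)
  next
    case False
    then show ?thesis using sgn[of j] that by (simp add: \<nu>'_def)
  qed
  obtain \<alpha> \<beta> where ab: "in_bands \<gamma> \<alpha> \<beta>" "\<And>j. j < N \<Longrightarrow> \<beta> j \<le> \<nu>' j" "\<And>j. j + 1 < N \<Longrightarrow> \<nu>' j \<le> \<alpha> (j + 1)"
    proof goal_cases
      case 1
      show ?case by (rule interlacing_of_separators[where \<nu> = \<nu>' and \<gamma> = \<gamma>]) (fact lead prod \<gamma> mono' sgn' 1)+
    qed
  show ?thesis
  proof (rule that[OF ab(1)])
    fix j assume j: "j + 1 < N"
    then have "j \<noteq> N - 1" "j < N - 1" by auto
    then have "\<nu>' j = sl_eig f q w N (bc_V K) j" using \<nu>(4)[of j] by (simp add: \<nu>'_def)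
    then show "\<beta> j \<le> sl_eig f q w N (bc_V K) j" "sl_eig f q w N (bc_V K) j \<le> \<alpha> (j + 1)"
      using ab(2)[of j] ab(3)[of j] j by simp_all
  qed
qed

end

section \<open>Assembly of the three cases for both signs of the matrix\<close>

theorem theorem3p11:
  fixes N :: nat and f q w :: "nat \<Rightarrow> real" and \<gamma> :: real and K :: "real^2^2"
  assumes N2: "N \<ge> 2"
    and f_nz: "\<forall>n\<le>N. f n \<noteq> 0"
    and w_pos: "\<forall>n\<in>{1..N}. w n > 0"
    and prod_pos: "(\<Prod>i=0..N-1. 1 / f i) > 0"
    and gamma: "-pi < \<gamma>" "\<gamma> < pi" "\<gamma> \<noteq> 0"
    and SL: "det K = 1"
    and K_cond: "K$1$1 - f 0 * K$1$2 \<noteq> 0"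
  shows "\<forall>M \<in> {K, -K}.
    (let lam = (\<lambda>A j. sl_eig f q w N (bc_coupled A) j);
         lM = lam (cmat M); lnM = lam (cmat (-M));
         lg = lam (\<chi> i j. exp (\<i> * complex_of_real \<gamma>) * cmat M $ i $ j);
         lV = (\<lambda>j. sl_eig f q w N (bc_V K) j);
         mn = (\<lambda>j. min (lM j) (lnM j)); mx = (\<lambda>j. max (lM j) (lnM j));
         P = (\<forall>j<N. (even j \<longrightarrow> lM j < lg j \<and> lg j < lnM j) \<and>
                     (odd j \<longrightarrow> lnM j < lg j \<and> lg j < lM j))
     in
     (M$1$1 - f 0 * M$1$2 > 0 \<and> f 0 * M$2$2 - M$2$1 > 0 \<longrightarrow>
        P \<and> (\<forall>j<N. lV j \<le> mn j) \<and> (\<forall>j. j + 1 < N \<longrightarrow> mx j \<le> lV (j+1)))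
   \<and> (M$1$1 - f 0 * M$1$2 > 0 \<and> f 0 * M$2$2 - M$2$1 < 0 \<longrightarrow>
        P \<and> (\<forall>j. j + 1 < N \<longrightarrow> mx j \<le> lV j \<and> lV j \<le> mn (j+1)) \<and> mx (N-1) \<le> lV (N-1))
   \<and> (M$1$1 - f 0 * M$1$2 > 0 \<and> f 0 * M$2$2 - M$2$1 = 0 \<longrightarrow>
        P \<and> (\<forall>j. j + 1 < N \<longrightarrow> mx j \<le> lV j \<and> lV j \<le> mn (j+1))))"
proof
  fix M assume MK: "M \<in> {K, - K}"
  have "det M = 1" using SL MK by (auto simp: det_2)
  then interpret sl_coupled N f q w M
    using N2 f_nz w_pos by unfold_locales auto
  \<comment> \<open>The separated condition is formed with \<open>K\<close> while the locale is
    instantiated at \<open>M\<close>; they agree up to sign, which \<open>bc_V_mult\<close>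
    absorbs.\<close>
  have KM: "K = M \<or> K = - M" using MK by auto
  have top: "(-1) ^ N * top_coeff > 0" using top_coeff_sign prod_pos by simp
  let ?e = "\<lambda>bc. sl_eig f q w N bc"
  let ?M = "?e (bc_coupled (cmat M))" and ?nM = "?e (bc_coupled (cmat (- M)))"
  let ?g = "?e (bc_coupled (\<chi> i j. exp (\<i> * complex_of_real \<gamma>) * cmat M $ i $ j))"
  \<comment> \<open>Whatever the parity of \<open>j\<close>, the smaller and the larger of the two
    eigenvalues are the left and right endpoints of band \<open>j\<close>.\<close>
  have bands: "(\<forall>j<N. (even j \<longrightarrow> ?M j < ?g j \<and> ?g j < ?nM j) \<and> (odd j \<longrightarrow> ?nM j < ?g j \<and> ?g j < ?M j))"
      "\<And>j. j < N \<Longrightarrow> min (?M j) (?nM j) = \<alpha> j" "\<And>j. j < N \<Longrightarrow> max (?M j) (?nM j) = \<beta> j"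
    if b: "in_bands \<gamma> \<alpha> \<beta>" for \<alpha> \<beta>
  proof -
    show "(\<forall>j<N. (even j \<longrightarrow> ?M j < ?g j \<and> ?g j < ?nM j) \<and> (odd j \<longrightarrow> ?nM j < ?g j \<and> ?g j < ?M j))"
      using b by (auto simp: in_bands_def)
    fix j assume "j < N"
    then have "?M j = (if even j then \<alpha> j else \<beta> j)" "?nM j = (if even j then \<beta> j else \<alpha> j)" "\<alpha> j < \<beta> j"
      using b less_trans unfolding in_bands_def by blast+
    then show "min (?M j) (?nM j) = \<alpha> j" "max (?M j) (?nM j) = \<beta> j" by auto
  qed
  show "let lam = (\<lambda>A j. sl_eig f q w N (bc_coupled A) j);
         lM = lam (cmat M); lnM = lam (cmat (-M));
         lg = lam (\<chi> i j. exp (\<i> * complex_of_real \<gamma>) * cmat M $ i $ j);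
         lV = (\<lambda>j. sl_eig f q w N (bc_V K) j);
         mn = (\<lambda>j. min (lM j) (lnM j)); mx = (\<lambda>j. max (lM j) (lnM j));
         P = (\<forall>j<N. (even j \<longrightarrow> lM j < lg j \<and> lg j < lnM j) \<and>
                     (odd j \<longrightarrow> lnM j < lg j \<and> lg j < lM j))
     in
     (M$1$1 - f 0 * M$1$2 > 0 \<and> f 0 * M$2$2 - M$2$1 > 0 \<longrightarrow>
        P \<and> (\<forall>j<N. lV j \<le> mn j) \<and> (\<forall>j. j + 1 < N \<longrightarrow> mx j \<le> lV (j+1)))
   \<and> (M$1$1 - f 0 * M$1$2 > 0 \<and> f 0 * M$2$2 - M$2$1 < 0 \<longrightarrow>
        P \<and> (\<forall>j. j + 1 < N \<longrightarrow> mx j \<le> lV j \<and> lV j \<le> mn (j+1)) \<and> mx (N-1) \<le> lV (N-1))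
   \<and> (M$1$1 - f 0 * M$1$2 > 0 \<and> f 0 * M$2$2 - M$2$1 = 0 \<longrightarrow>
        P \<and> (\<forall>j. j + 1 < N \<longrightarrow> mx j \<le> lV j \<and> lV j \<le> mn (j+1)))"
    unfolding Let_def
  proof (intro conjI[of "_ \<longrightarrow> _"] impI, goal_cases)
    case 1
    then obtain \<alpha> \<beta> where ab: "in_bands \<gamma> \<alpha> \<beta>"
      "\<And>j. j < N \<Longrightarrow> ?e (bc_V K) j \<le> \<alpha> j" "\<And>j. j + 1 < N \<Longrightarrow> \<beta> j \<le> ?e (bc_V K) (j + 1)"
      using interlacing_pos[OF _ top gamma _ KM] by blast
    show ?case using bands[OF ab(1)] ab(2,3) by simp
  next
    case 2
    then obtain \<alpha> \<beta> where ab: "in_bands \<gamma> \<alpha> \<beta>"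
      "\<And>j. j < N \<Longrightarrow> \<beta> j \<le> ?e (bc_V K) j" "\<And>j. j + 1 < N \<Longrightarrow> ?e (bc_V K) j \<le> \<alpha> (j + 1)"
      using interlacing_neg[OF _ top gamma _ KM] by blast
    show ?case using bands[OF ab(1)] ab(2,3) N2 by simp
  next
    case 3
    then obtain \<alpha> \<beta> where ab: "in_bands \<gamma> \<alpha> \<beta>"
      "\<And>j. j + 1 < N \<Longrightarrow> \<beta> j \<le> ?e (bc_V K) j" "\<And>j. j + 1 < N \<Longrightarrow> ?e (bc_V K) j \<le> \<alpha> (j + 1)"
      using interlacing_exceptional[OF _ top gamma _ KM] by blast
    show ?case using bands[OF ab(1)] ab(2,3) by simp
  qed
qed

end
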